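(* Let $G$ be a finite simple outerplanar graph, drawn in the plane with all vertices on the outer face, and let $B$ be a block of $G$ (a maximal connected subgraph without a cut vertex). (1) If $B$ is a bridge (a single edge), or $B$ contains an inner face $F$ with $|V(F)|\neq 5$, then $B$ has a complete conflict-free coloring with at most $4$ colors: a map $C:V(B)\to\{1,2,3,4\}$ such that every $w\in V(B)$ has a color appearing exactly once among the colors of its neighbors in $B$. (2) Let $v\in V(B)$ and let $c,u\in\{1,2,3,4\}$ with $c\neq u$. Then there is a map $C:V(B)\to\{1,2,3,4\}$ with $C(v)=c$, such that no neighbor of $v$ in $B$ receives color $u$, and every vertex $w\in V(B)\setminus\{v\}$ has a color appearing exactly once among the colors of its neighbors in $B$.
   Context: Part (2) formalizes the statement that if exactly one vertex $v$ of $B$ is precolored with color $c$ and has already a uniquely colored neighbor (outside $B$) of color $u\neq c$, then the rest of $B$ can be colored with at most $4$ colors so that $v$ keeps its color $c$ and its unique color $u$. Inner faces are bounded faces of the outerplanar drawing. *)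

theory Defs
  imports "HOL-Analysis.Analysis" "Graph_Theory.Graph_Theory"
begin

(* A finite simple graph is a pair_graph: an undirected edge {x, y} is represented by the two
   arcs (x, y) and (y, x).  Both imports declare a constant "connected", hence the qualified
   names. *)

definition cut_vertex :: "('a, 'b) pre_digraph \<Rightarrow> 'a \<Rightarrow> bool" where
  "cut_vertex H v \<longleftrightarrow> v \<in> verts H \<and>
     (\<exists>x \<in> verts H - {v}. \<exists>y \<in> verts H - {v}.
        reachable H x y \<and> \<not> reachable (pre_digraph.del_vert H v) x y)"

(* The conjunct "graph H" restricts the candidates to undirected subgraphs.  The null graph is
   not connected in the library's sense; an isolated vertex is a block. *)
definition block :: "'a pair_pre_digraph \<Rightarrow> 'a pair_pre_digraph \<Rightarrow> bool" where
  "block G B \<longleftrightarrow> pre_digraph.max_subgraph (with_proj G)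
     (\<lambda>H. graph H \<and> Digraph_Component.connected H \<and> (\<forall>v. \<not> cut_vertex H v)) (with_proj B)"

definition single_edge :: "'a pair_pre_digraph \<Rightarrow> bool" where
  "single_edge B \<longleftrightarrow> (\<exists>x y. x \<noteq> y \<and> pverts B = {x, y} \<and> parcs B = {(x, y), (y, x)})"

(* The plane is the type complex.  Vertex x is drawn as the point pos x, and the edge {x, y} as
   the common image of the arcs crv (x, y) and crv (y, x). *)
definition plane_drawing ::
    "'a pair_pre_digraph \<Rightarrow> ('a \<Rightarrow> complex) \<Rightarrow> ('a \<times> 'a \<Rightarrow> real \<Rightarrow> complex) \<Rightarrow> bool" where
  "plane_drawing G pos crv \<longleftrightarrow>
     inj_on pos (pverts G) \<and>
     (\<forall>(x, y) \<in> parcs G.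
        Path_Connected.arc (crv (x, y)) \<and>
        pathstart (crv (x, y)) = pos x \<and> pathfinish (crv (x, y)) = pos y \<and>
        path_image (crv (y, x)) = path_image (crv (x, y)) \<and>
        path_image (crv (x, y)) \<inter> pos ` pverts G \<subseteq> {pos x, pos y}) \<and>
     (\<forall>(x, y) \<in> parcs G. \<forall>(x', y') \<in> parcs G. {x, y} \<noteq> {x', y'} \<longrightarrow>
        path_image (crv (x, y)) \<inter> path_image (crv (x', y')) \<subseteq> pos ` ({x, y} \<inter> {x', y'}))"

definition drawing_points ::
    "'a pair_pre_digraph \<Rightarrow> ('a \<Rightarrow> complex) \<Rightarrow> ('a \<times> 'a \<Rightarrow> real \<Rightarrow> complex) \<Rightarrow> complex set" where
  "drawing_points G pos crv = pos ` pverts G \<union> (\<Union>e \<in> parcs G. path_image (crv e))"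

definition faces ::
    "'a pair_pre_digraph \<Rightarrow> ('a \<Rightarrow> complex) \<Rightarrow> ('a \<times> 'a \<Rightarrow> real \<Rightarrow> complex) \<Rightarrow> complex set set" where
  "faces G pos crv = components (- drawing_points G pos crv)"

definition inner_faces ::
    "'a pair_pre_digraph \<Rightarrow> ('a \<Rightarrow> complex) \<Rightarrow> ('a \<times> 'a \<Rightarrow> real \<Rightarrow> complex) \<Rightarrow> complex set set" where
  "inner_faces G pos crv = {F \<in> faces G pos crv. bounded F}"

definition face_verts ::
    "'a pair_pre_digraph \<Rightarrow> ('a \<Rightarrow> complex) \<Rightarrow> complex set \<Rightarrow> 'a set" where
  "face_verts G pos F = {x \<in> pverts G. pos x \<in> frontier F}"

(* The drawing of a finite graph is compact, so it has exactly one unbounded face. *)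
definition outerplanar_drawing ::
    "'a pair_pre_digraph \<Rightarrow> ('a \<Rightarrow> complex) \<Rightarrow> ('a \<times> 'a \<Rightarrow> real \<Rightarrow> complex) \<Rightarrow> bool" where
  "outerplanar_drawing G pos crv \<longleftrightarrow> plane_drawing G pos crv \<and>
     (\<exists>F \<in> faces G pos crv. \<not> bounded F \<and> pverts G \<subseteq> face_verts G pos F)"

(* Membership of a face of the drawing of G in a subgraph B: its boundary is drawn by B. *)
definition contains_face ::
    "'a pair_pre_digraph \<Rightarrow> ('a \<Rightarrow> complex) \<Rightarrow> ('a \<times> 'a \<Rightarrow> real \<Rightarrow> complex) \<Rightarrow> complex set \<Rightarrow> bool" where
  "contains_face B pos crv F \<longleftrightarrow> frontier F \<subseteq> drawing_points B pos crv"

definition has_unique_color :: "'a pair_pre_digraph \<Rightarrow> ('a \<Rightarrow> nat) \<Rightarrow> 'a \<Rightarrow> bool" where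
  "has_unique_color B C w \<longleftrightarrow> (\<exists>k. \<exists>!x. (w, x) \<in> parcs B \<and> C x = k)"

definition conflict_free_coloring :: "'a pair_pre_digraph \<Rightarrow> nat set \<Rightarrow> ('a \<Rightarrow> nat) \<Rightarrow> bool" where
  "conflict_free_coloring B K C \<longleftrightarrow>
     C \<in> pverts B \<rightarrow> K \<and> (\<forall>w \<in> pverts B. has_unique_color B C w)"

end

theory Submission
  imports Defs
begin

text \<open>A longest cycle of a block with at least two vertices (a single edge counts as a cycle) is
  Hamiltonian: a vertex off the cycle would give an ear, and then either a longer cycle or three
  internally disjoint paths with inner vertices, one of which is drawn inside the other two. For
  the same reason the chords lie inside the Hamiltonian cycle and do not cross. An induction over
  the intervals of the cycle that are closed under adjacency then yields the colorings with four
  colors.\<close>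

section \<open>Theta curves in the plane\<close>

text \<open>The drawing is used through one fact: a vertex on the boundary of the unbounded face is
  never inside a closed curve made of edges. So if one of three parallel paths is drawn inside the
  other two, it has no inner vertex and is a single edge. The coloring is delicate at a vertex where
  two intervals of the cycle meet, since its neighbors lie in both: a color seen once in one
  interval is spoiled if the other interval shows it too. The invariant therefore lets the caller
  name a color that the first vertex must not see, and ask that the last vertex see its own color
  once or never. One side can then supply the unique color while the other side avoids it. The color
  of the meeting vertex may have to differ from three given colors at once, those of both ends and
  the forbidden one; this is where four colors come from.\<close>

lemma connected_inside_or_outside:
  fixes S J :: "complex set"
  assumes "Topological_Spaces.connected S" "closed J" "S \<inter> J = {}"
  shows "S \<subseteq> inside J \<or> S \<subseteq> outside J"
proof (rule ccontr)
  assume *: "\<not> ?thesis"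
  have "S \<subseteq> inside J \<union> outside J" using assms(3) by (auto simp: inside_Un_outside)
  moreover have "open (inside J)" "open (outside J)" "inside J \<inter> outside J = {}"
    using assms(2) by (auto simp: open_inside open_outside inside_Int_outside)
  ultimately show False
    using connectedD[OF assms(1), of "inside J" "outside J"] * by blast
qed

locale two_arcs =
  fixes g h :: "real \<Rightarrow> complex" and a b :: complex
  assumes arcs: "Path_Connected.arc g" "Path_Connected.arc h"
    and ends: "pathstart g = a" "pathfinish g = b" "pathstart h = a" "pathfinish h = b"
    and meet: "path_image g \<inter> path_image h = {a, b}"
begin

lemma closed_curve:
  "simple_path (g +++ reversepath h)" "pathfinish (g +++ reversepath h) = pathstart (g +++ reversepath h)"
  "path_image (g +++ reversepath h) = path_image g \<union> path_image h"
  using arcs ends meet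
  by (auto intro!: simple_path_join_loop simp: arc_reversepath path_image_join)

lemmas jordan = Jordan_inside_outside[OF closed_curve(1,2), unfolded closed_curve(3)]

lemma ends_distinct: "a \<noteq> b"
  using arc_distinct_ends[OF arcs(1)] ends by simp

end

text \<open>The last claim, that the ends are limits of the rest of the arc, later traps the ends of
  a chord in the closure of the region that contains its interior.\<close>

lemma arc_interior:
  fixes g :: "real \<Rightarrow> complex"
  assumes "Path_Connected.arc g" "pathstart g = a" "pathfinish g = b"
  shows "Topological_Spaces.connected (path_image g - {a, b})" "path_image g - {a, b} \<noteq> {}"
    "{a, b} \<subseteq> path_image g" "Topological_Spaces.connected (path_image g)" "compact (path_image g)"
    "{a, b} \<subseteq> closure (path_image g - {a, b})"
proof -
  have s: "simple_path g" using assms arc_imp_simple_path by blast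
  show "Topological_Spaces.connected (path_image g - {a, b})" "path_image g - {a, b} \<noteq> {}"
    using connected_simple_path_endless[OF s] nonempty_simple_path_endless[OF s] assms by auto
  show "{a, b} \<subseteq> path_image g" using assms by auto
  show "Topological_Spaces.connected (path_image g)" "compact (path_image g)"
    using assms connected_path_image compact_path_image arc_imp_path by blast+
  have inj: "inj_on g {0..1}" and cont: "continuous_on {0..1} g"
    using assms(1) by (auto simp: arc_def path_def)
  have "g t \<in> path_image g - {a, b}" if "t \<in> {0<..<1}" for t
    using that inj_onD[OF inj, of t 0] inj_onD[OF inj, of t 1] assms
    by (auto simp: path_image_def pathstart_def pathfinish_def)
  then have sub: "g ` {0<..<1} \<subseteq> closure (path_image g - {a, b})"
    using closure_subset by blast
  have cl: "closure {0<..<1} = {0..1::real}" by (simp add: closure_greaterThanLessThan)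
  have "g ` closure {0<..<1} \<subseteq> closure (path_image g - {a, b})"
    by (rule image_closure_subset) (use cont sub cl in auto)
  moreover have "a = g 0" "b = g 1" using assms by (auto simp: pathstart_def pathfinish_def)
  ultimately show "{a, b} \<subseteq> closure (path_image g - {a, b})" unfolding cl by force
qed

locale theta_curve =
  fixes g1 g2 g3 :: "real \<Rightarrow> complex" and a b :: complex
  assumes arcs: "Path_Connected.arc g1" "Path_Connected.arc g2" "Path_Connected.arc g3"
    and starts: "pathstart g1 = a" "pathstart g2 = a" "pathstart g3 = a"
    and finishes: "pathfinish g1 = b" "pathfinish g2 = b" "pathfinish g3 = b"
    and meets: "path_image g1 \<inter> path_image g2 = {a, b}" "path_image g1 \<inter> path_image g3 = {a, b}"
      "path_image g2 \<inter> path_image g3 = {a, b}"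
begin

sublocale c12: two_arcs g1 g2 a b by unfold_locales (use arcs starts finishes meets in auto)
sublocale c13: two_arcs g1 g3 a b by unfold_locales (use arcs starts finishes meets in auto)
sublocale c23: two_arcs g2 g3 a b by unfold_locales (use arcs starts finishes meets in auto)

text \<open>Each inner region misses the other closed curve, because the remaining arc lies outside.
  If the regions met, connectedness would put each inside the other; equal regions have equal
  frontiers, so by the Jordan curve theorem the two curves would coincide, although only one of them
  contains the interior of \<open>g1\<close>.\<close>

lemma inside_disjoint:
  assumes "path_image g1 - {a, b} \<subseteq> outside (path_image g2 \<union> path_image g3)"
    and "path_image g3 - {a, b} \<subseteq> outside (path_image g1 \<union> path_image g2)"
  shows "inside (path_image g2 \<union> path_image g3) \<inter> inside (path_image g1 \<union> path_image g2) = {}"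
proof (rule ccontr)
  assume *: "\<not> ?thesis"
  let ?I = "inside (path_image g2 \<union> path_image g3)" and ?J = "inside (path_image g1 \<union> path_image g2)"
  have I: "?I \<inter> (path_image g1 \<union> path_image g2) = {}"
    using assms(1) arc_interior(3)[OF arcs(2) starts(2) finishes(2)]
      inside_Int_outside[of "path_image g2 \<union> path_image g3"] inside_no_overlap[of "path_image g2 \<union> path_image g3"]
    by blast
  have J: "?J \<inter> (path_image g2 \<union> path_image g3) = {}"
    using assms(2) arc_interior(3)[OF arcs(2) starts(2) finishes(2)]
      inside_Int_outside[of "path_image g1 \<union> path_image g2"] inside_no_overlap[of "path_image g1 \<union> path_image g2"]
    by blast
  have closed: "closed (path_image g1 \<union> path_image g2)" "closed (path_image g2 \<union> path_image g3)"
    using arcs by (auto intro!: closed_Un simp: closed_arc_image)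
  have "?I \<subseteq> ?J"
    using connected_inside_or_outside[OF _ closed(1) I] c23.jordan *
      inside_Int_outside[of "path_image g1 \<union> path_image g2"] by blast
  moreover have "?J \<subseteq> ?I"
    using connected_inside_or_outside[OF _ closed(2) J] c12.jordan *
      inside_Int_outside[of "path_image g2 \<union> path_image g3"] by blast
  ultimately have "?I = ?J" by blast
  then have "path_image g2 \<union> path_image g3 = path_image g1 \<union> path_image g2"
    using c23.jordan c12.jordan by metis
  then show False
    using arc_interior(2)[OF arcs(1) starts(1) finishes(1)] meets by blast
qed

end

lemma (in theta_curve) theta_swap: "theta_curve g1 g3 g2 a b"
  by unfold_locales (use arcs starts finishes meets in auto)

text \<open>If all three arcs lay outside, the three inner regions would be pairwise disjoint, and
  Janiszewski's theorem would join a point inside two of the arcs to infinity in the complement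
  of all three.\<close>

theorem (in theta_curve) some_arc_inside:
  "path_image g1 - {a, b} \<subseteq> inside (path_image g2 \<union> path_image g3) \<or>
   path_image g2 - {a, b} \<subseteq> inside (path_image g1 \<union> path_image g3) \<or>
   path_image g3 - {a, b} \<subseteq> inside (path_image g1 \<union> path_image g2)"
proof (rule ccontr)
  assume neg: "\<not> ?thesis"
  let ?p1 = "path_image g1" and ?p2 = "path_image g2" and ?p3 = "path_image g3"
  note i1 = arc_interior[OF arcs(1) starts(1) finishes(1)]
  note i2 = arc_interior[OF arcs(2) starts(2) finishes(2)]
  note i3 = arc_interior[OF arcs(3) starts(3) finishes(3)]
  have cl: "closed ?p1" "closed ?p2" "closed ?p3" using arcs by (auto simp: closed_arc_image)
  have out: "?p1 - {a, b} \<subseteq> outside (?p2 \<union> ?p3)" "?p2 - {a, b} \<subseteq> outside (?p1 \<union> ?p3)"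
     "?p3 - {a, b} \<subseteq> outside (?p1 \<union> ?p2)"
  proof -
    have *: "S - {a, b} \<subseteq> outside (T \<union> U)"
      if "Topological_Spaces.connected (S - {a, b})" "closed T" "closed U" "S \<inter> T = {a, b}" "S \<inter> U = {a, b}"
        "\<not> S - {a, b} \<subseteq> inside (T \<union> U)" for S T U :: "complex set"
    proof -
      have "(S - {a, b}) \<inter> (T \<union> U) = {}" using that(4,5) by blast
      with connected_inside_or_outside[OF that(1) closed_Un[OF that(2,3)]] that(6) show ?thesis by blast
    qed
    show "?p1 - {a, b} \<subseteq> outside (?p2 \<union> ?p3)"
      by (rule *[OF i1(1) cl(2,3) meets(1,2)]) (use neg in blast)
    show "?p2 - {a, b} \<subseteq> outside (?p1 \<union> ?p3)"
      by (rule *[OF i2(1) cl(1,3)]) (use neg meets in \<open>simp_all add: Int_commute\<close>)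
    show "?p3 - {a, b} \<subseteq> outside (?p1 \<union> ?p2)"
      by (rule *[OF i3(1) cl(1,2)]) (use neg meets in \<open>simp_all add: Int_commute\<close>)
  qed
  obtain x where x: "x \<in> inside (?p2 \<union> ?p3)" using c23.jordan by blast
  have "x \<notin> inside (?p1 \<union> ?p2)" using inside_disjoint out x by blast
  moreover have "x \<notin> inside (?p1 \<union> ?p3)"
    using theta_curve.inside_disjoint[OF theta_swap] out x by (simp add: Un_commute) blast
  moreover have "x \<notin> ?p1 \<union> ?p2 \<union> ?p3"
    using x out(1) i2(3) inside_Int_outside[of "?p2 \<union> ?p3"] inside_no_overlap[of "?p2 \<union> ?p3"] by blast
  ultimately have x_out: "x \<in> outside (?p1 \<union> ?p2)" "x \<in> outside (?p1 \<union> ?p3)"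
    by (simp_all add: outside_inside)
  have "bounded (?p1 \<union> ?p2 \<union> ?p3)" using i1(5) i2(5) i3(5) by (simp add: compact_imp_bounded)
  then obtain r where r: "?p1 \<union> ?p2 \<union> ?p3 \<subseteq> ball 0 r" using bounded_subset_ballD by blast
  \<comment> \<open>A point beyond a ball around the whole theta curve is outside all three closed
    curves.\<close>
  define y :: complex where "y = of_real r"
  have "y \<notin> ball 0 r" by (simp add: y_def)
  then have y: "y \<in> outside (?p1 \<union> ?p2)" "y \<in> outside (?p1 \<union> ?p3)" "y \<in> outside (?p2 \<union> ?p3)"
    using outside_subset_convex[OF convex_ball, of "?p1 \<union> ?p2" "0 :: complex" r]
      outside_subset_convex[OF convex_ball, of "?p1 \<union> ?p3" "0 :: complex" r]
      outside_subset_convex[OF convex_ball, of "?p2 \<union> ?p3" "0 :: complex" r] r by blast+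
  have outside_sub: "outside S \<subseteq> - S" for S :: "complex set" using outside_no_overlap[of S] by blast
  have xy12: "connected_component (- (?p1 \<union> ?p2)) x y"
    unfolding connected_component_def
    by (rule exI[of _ "outside (?p1 \<union> ?p2)"]) (use c12.jordan x_out y outside_sub in blast)
  have xy13: "connected_component (- (?p1 \<union> ?p3)) x y"
    unfolding connected_component_def
    by (rule exI[of _ "outside (?p1 \<union> ?p3)"]) (use c13.jordan x_out y outside_sub in blast)
  \<comment> \<open>Janiszewski's theorem needs the common part of the two sets to be connected;
    here it is a single arc.\<close>
  have "(?p1 \<union> ?p2) \<inter> (?p1 \<union> ?p3) = ?p1" using meets i1(3) by blast
  then have "Topological_Spaces.connected ((?p1 \<union> ?p2) \<inter> (?p1 \<union> ?p3))" using i1(4) by metis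
  from Janiszewski[OF compact_Un[OF i1(5) i2(5)] closed_Un[OF cl(1,3)] this xy12 xy13]
  have "connected_component (- ((?p1 \<union> ?p2) \<union> (?p1 \<union> ?p3))) x y" .
  then have "connected_component (- (?p2 \<union> ?p3)) x y"
    unfolding connected_component_def by blast
  then have "x \<in> outside (?p2 \<union> ?p3)"
    using y(3) outside_same_component connected_component_sym by blast
  then show False using x inside_Int_outside by blast
qed

text \<open>The arc \<open>g3\<close> cuts the inner region in two, and the interior of
  \<open>d\<close>, connected and disjoint from \<open>g3\<close>, stays in one half. The end of
  \<open>d\<close> that belongs to the other half then lies in the closure of the wrong region:
  either in the region, which the last two hypotheses exclude, or on its boundary, where the arcs
  meet only in \<open>a\<close> and \<open>b\<close>. Outerplanarity will supply those two
  hypotheses, since \<open>k\<close> and \<open>l\<close> will be vertices.\<close>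

lemma (in theta_curve) no_crossing_arc:
  assumes "Path_Connected.arc d" "pathstart d = k" "pathfinish d = l"
    and k: "k \<in> path_image g1 - {a, b}" and l: "l \<in> path_image g2 - {a, b}"
    and d: "path_image d \<inter> path_image g3 = {}"
    and g3_inside: "path_image g3 - {a, b} \<subseteq> inside (path_image g1 \<union> path_image g2)"
    and d_inside: "path_image d - {k, l} \<subseteq> inside (path_image g1 \<union> path_image g2)"
    and "k \<notin> inside (path_image g2 \<union> path_image g3)" "l \<notin> inside (path_image g1 \<union> path_image g3)"
  shows False
proof -
  let ?d = "path_image d - {k, l}"
  note i3 = arc_interior[OF arcs(3) starts(3) finishes(3)]
  note i = arc_interior[OF assms(1-3)]
  have ne: "path_image g3 \<inter> inside (path_image g1 \<union> path_image g2) \<noteq> {}" using i3(2) g3_inside by blast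
  from split_inside_simple_closed_curve[OF arc_imp_simple_path[OF arcs(1)] starts(1) finishes(1)
      arc_imp_simple_path[OF arcs(2)] starts(2) finishes(2) arc_imp_simple_path[OF arcs(3)] starts(3) finishes(3)
      c12.ends_distinct meets ne]
  have disj: "inside (path_image g1 \<union> path_image g3) \<inter> inside (path_image g2 \<union> path_image g3) = {}"
    and un: "inside (path_image g1 \<union> path_image g3) \<union> inside (path_image g2 \<union> path_image g3) \<union>
      (path_image g3 - {a, b}) = inside (path_image g1 \<union> path_image g2)" by blast+
  have "?d \<subseteq> inside (path_image g1 \<union> path_image g3) \<union> inside (path_image g2 \<union> path_image g3)"
    using d_inside un d by blast
  moreover have "open (inside (path_image g1 \<union> path_image g3))" "open (inside (path_image g2 \<union> path_image g3))"
    using c13.jordan c23.jordan by blast+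
  ultimately consider "?d \<subseteq> inside (path_image g1 \<union> path_image g3)" | "?d \<subseteq> inside (path_image g2 \<union> path_image g3)"
    using connectedD[OF i(1), of "inside (path_image g1 \<union> path_image g3)" "inside (path_image g2 \<union> path_image g3)"] disj
    by blast
  then show False
  proof cases
    case 1
    then have "l \<in> closure (inside (path_image g1 \<union> path_image g3))" using i(6) closure_mono by blast
    then have "l \<in> path_image g1 \<union> path_image g3"
      using assms c13.jordan closure_Un_frontier by (metis UnE)
    then show False using l meets(1,3) by blast
  next
    case 2
    then have "k \<in> closure (inside (path_image g2 \<union> path_image g3))" using i(6) closure_mono by blast
    then have "k \<in> path_image g2 \<union> path_image g3"
      using assms c23.jordan closure_Un_frontier by (metis UnE)
    then show False using k meets(1,2) by blast
  qed
qed

section \<open>Walks in an outerplanar drawing\<close>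

fun walk_trace :: "('a \<times> 'a \<Rightarrow> real \<Rightarrow> complex) \<Rightarrow> 'a list \<Rightarrow> complex set" where
  "walk_trace crv (x # y # zs) = path_image (crv (x, y)) \<union> walk_trace crv (y # zs)"
| "walk_trace crv _ = {}"

text \<open>Edges are unordered because both orientations of an edge are drawn as the same
  curve.\<close>

fun walk_edges :: "'a list \<Rightarrow> 'a set set" where
  "walk_edges (x # y # zs) = insert {x, y} (walk_edges (y # zs))"
| "walk_edges _ = {}"

abbreviation walk :: "('a \<times> 'a) set \<Rightarrow> 'a list \<Rightarrow> bool" where
  "walk E \<equiv> successively (\<lambda>x y. (x, y) \<in> E)"

lemma edges_subset: "e \<in> walk_edges xs \<Longrightarrow> e \<subseteq> set xs"
  by (induction xs rule: walk_edges.induct) auto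

lemma trace_append: "walk_trace crv (xs @ m # ys) = walk_trace crv (xs @ [m]) \<union> walk_trace crv (m # ys)"
proof (induction xs rule: walk_edges.induct)
  case ("2_2" v)
  then show ?case by (cases ys) auto
qed auto

text \<open>If there is an inner vertex, the first edge ends in it and all later edges avoid
  \<open>z\<close>. This serves to show that parallel paths share no edge.\<close>

lemma edges_ends: "\<lbrakk>distinct (z # A @ [t]); {z, t} \<in> walk_edges (z # A @ [t])\<rbrakk> \<Longrightarrow> A = []"
proof (cases A)
  case (Cons a A')
  assume *: "distinct (z # A @ [t])" "{z, t} \<in> walk_edges (z # A @ [t])"
  then have "{z, t} = {z, a} \<or> {z, t} \<in> walk_edges (A @ [t])" using Cons by auto
  then show ?thesis using * Cons edges_subset[of "{z, t}" "A @ [t]"] by (auto simp: doubleton_eq_iff)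
qed

lemma walk_verts: "\<lbrakk>walk E xs; 2 \<le> length xs; E \<subseteq> V \<times> V\<rbrakk> \<Longrightarrow> set xs \<subseteq> V"
proof (induction xs rule: walk_edges.induct)
  case (1 x y zs)
  then show ?case by (cases zs) auto
qed auto

lemma walk_rev: "\<lbrakk>sym E; walk E xs\<rbrakk> \<Longrightarrow> walk E (rev xs)"
  unfolding successively_rev by (metis (no_types, lifting) successively_mono symE)

lemma walk_split: "walk E (xs @ m # ys) \<longleftrightarrow> walk E (xs @ [m]) \<and> walk E (m # ys)"
  by (auto simp: successively_append_iff)

text \<open>The second walk uses the closing edge and runs backwards, so that both sides of the
  cycle lead from \<open>i\<close> to \<open>j\<close>.\<close>

lemma cycle_as_two_walks:
  assumes "sym E" "walk E (i # A @ j # B)" "(last (j # B), i) \<in> E"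
  shows "walk E (i # A @ [j])" "walk E (i # rev B @ [j])"
proof -
  have *: "walk E (i # A @ [j])" "walk E (j # B)" using assms(2) walk_split[of E "i # A" j B] by simp_all
  then show "walk E (i # A @ [j])" by simp
  have "walk E ((j # B) @ [i])" using *(2) assms(3) unfolding successively_append_iff by simp
  then have "walk E (rev ((j # B) @ [i]))" by (rule walk_rev[OF assms(1)])
  then show "walk E (i # rev B @ [j])" by simp
qed

locale drawn_graph =
  fixes G :: "'a pair_pre_digraph" and pos :: "'a \<Rightarrow> complex" and crv :: "'a \<times> 'a \<Rightarrow> real \<Rightarrow> complex"
  assumes graph: "pair_graph G" and drawing: "plane_drawing G pos crv"
begin

abbreviation "E \<equiv> parcs G"
abbreviation "V \<equiv> pverts G"

lemma arcs_verts: "E \<subseteq> V \<times> V"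
  using pair_wf_digraph.in_arcsD1 pair_wf_digraph.in_arcsD2 graph
  by (fastforce simp: pair_graph_def pair_digraph_def pair_fin_digraph_def)

lemma sym_arcs: "sym E"
proof -
  interpret pair_graph G by (rule graph)
  show ?thesis using pair_sym_arcs by (simp add: symmetric_def)
qed

lemma pos_inj: "\<lbrakk>x \<in> V; y \<in> V\<rbrakk> \<Longrightarrow> pos x = pos y \<longleftrightarrow> x = y"
  using drawing by (auto simp: plane_drawing_def inj_on_def)

lemma edge_curve:
  assumes "(x, y) \<in> E"
  shows "Path_Connected.arc (crv (x, y))" "pathstart (crv (x, y)) = pos x" "pathfinish (crv (x, y)) = pos y"
    "path_image (crv (y, x)) = path_image (crv (x, y))"
    "path_image (crv (x, y)) \<inter> pos ` V \<subseteq> {pos x, pos y}"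
  using drawing assms unfolding plane_drawing_def by blast+

lemma edge_curves_meet:
  assumes "(x, y) \<in> E" "(x', y') \<in> E" "{x, y} \<noteq> {x', y'}"
  shows "path_image (crv (x, y)) \<inter> path_image (crv (x', y')) \<subseteq> pos ` ({x, y} \<inter> {x', y'})"
  using drawing assms unfolding plane_drawing_def by blast

lemma trace_edge_meet:
  "\<lbrakk>(x, y) \<in> E; walk E ys; {x, y} \<notin> walk_edges ys\<rbrakk>
    \<Longrightarrow> path_image (crv (x, y)) \<inter> walk_trace crv ys \<subseteq> pos ` ({x, y} \<inter> set ys)"
proof (induction ys rule: walk_edges.induct)
  case (1 a b zs)
  have "path_image (crv (x, y)) \<inter> path_image (crv (a, b)) \<subseteq> pos ` ({x, y} \<inter> {a, b})"
    using edge_curves_meet[of x y a b] 1 by simp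
  with 1 show ?case by auto
qed auto

lemma trace_meet:
  "\<lbrakk>walk E xs; walk E ys; walk_edges xs \<inter> walk_edges ys = {}\<rbrakk>
    \<Longrightarrow> walk_trace crv xs \<inter> walk_trace crv ys \<subseteq> pos ` (set xs \<inter> set ys)"
proof (induction xs rule: walk_edges.induct)
  case (1 a b zs)
  have "path_image (crv (a, b)) \<inter> walk_trace crv ys \<subseteq> pos ` ({a, b} \<inter> set ys)"
    using trace_edge_meet[of a b ys] 1 by simp
  with 1 show ?case by auto
qed auto

lemma pos_in_trace: "\<lbrakk>walk E xs; 2 \<le> length xs; x \<in> set xs\<rbrakk> \<Longrightarrow> pos x \<in> walk_trace crv xs"
proof (induction xs rule: walk_edges.induct)
  case (1 a b zs)
  then have "pos a \<in> path_image (crv (a, b))" "pos b \<in> path_image (crv (a, b))"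
    using edge_curve[of a b] pathstart_in_path_image pathfinish_in_path_image by (metis successively.simps(3))+
  then show ?case using 1 by (cases zs) auto
qed auto

lemma trace_subset_drawing: "walk E xs \<Longrightarrow> walk_trace crv xs \<subseteq> drawing_points G pos crv"
  by (induction xs rule: walk_edges.induct) (auto simp: drawing_points_def)

lemma trace_rev: "walk E xs \<Longrightarrow> walk_trace crv (rev xs) = walk_trace crv xs"
proof (induction xs rule: walk_edges.induct)
  case (1 a b zs)
  then have "walk_trace crv (rev (b # zs)) = walk_trace crv (b # zs)" by simp
  then show ?case using 1 edge_curve(4)[of a b] trace_append[of crv "rev zs" b "[a]"] by auto
qed auto

lemma walk_arc:
  "\<lbrakk>walk E xs; distinct xs; 2 \<le> length xs\<rbrakk> \<Longrightarrow>
    \<exists>g. Path_Connected.arc g \<and> pathstart g = pos (hd xs) \<and> pathfinish g = pos (last xs) \<and> path_image g = walk_trace crv xs"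
proof (induction xs rule: walk_edges.induct)
  case (1 x y zs)
  then have xy: "(x, y) \<in> E" by simp
  note c = edge_curve[OF xy]
  show ?case
  proof (cases zs)
    case Nil
    then show ?thesis using c by (intro exI[of _ "crv (x, y)"]) simp
  next
    case (Cons z zs')
    then obtain g where g: "Path_Connected.arc g" "pathstart g = pos y" "pathfinish g = pos (last zs)"
      "path_image g = walk_trace crv (y # zs)" using 1 by auto
    have "{x, y} \<notin> walk_edges (y # zs)" using edges_subset[of "{x, y}" "y # zs"] 1 by auto
    then have "path_image (crv (x, y)) \<inter> path_image g \<subseteq> {pos y}"
      using trace_edge_meet[OF xy, of "y # zs"] 1 g(4) by auto
    then have "Path_Connected.arc (crv (x, y) +++ g)" using c g by (intro arc_join) auto
    then show ?thesis using c g Cons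
      by (intro exI[of _ "crv (x, y) +++ g"]) (auto simp: path_image_join)
  qed
qed auto

lemma parallel_walks_meet:
  assumes "walk E (z # A @ [t])" "walk E (z # B @ [t])"
    and dist: "distinct (z # t # A @ B)" and ne: "A \<noteq> [] \<or> B \<noteq> []"
  shows "walk_trace crv (z # A @ [t]) \<inter> walk_trace crv (z # B @ [t]) = {pos z, pos t}"
proof
  \<comment> \<open>A common edge would have both ends among \<open>z\<close> and \<open>t\<close>,
    and then both paths would consist of that edge alone.\<close>
  have "walk_edges (z # A @ [t]) \<inter> walk_edges (z # B @ [t]) = {}"
  proof (rule ccontr)
    assume "\<not> ?thesis"
    then obtain e where e: "e \<in> walk_edges (z # A @ [t])" "e \<in> walk_edges (z # B @ [t])" by blast
    have two: "\<exists>x y. x \<noteq> y \<and> e = {x, y}" if "distinct xs" "e \<in> walk_edges xs" for xs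
      using that by (induction xs rule: walk_edges.induct) auto
    have "distinct (z # A @ [t])" using dist by auto
    then obtain x y where "x \<noteq> y" "e = {x, y}" using two[OF _ e(1)] by blast
    moreover have "e \<subseteq> {z, t}" using edges_subset[OF e(1)] edges_subset[OF e(2)] dist by auto
    ultimately have "e = {z, t}" by auto
    then show False using edges_ends[of z A t] edges_ends[of z B t] e dist ne by auto
  qed
  moreover have "set (z # A @ [t]) \<inter> set (z # B @ [t]) = {z, t}" using dist by auto
  ultimately show "walk_trace crv (z # A @ [t]) \<inter> walk_trace crv (z # B @ [t]) \<subseteq> {pos z, pos t}"
    using trace_meet[OF assms(1,2)] by auto
  show "{pos z, pos t} \<subseteq> walk_trace crv (z # A @ [t]) \<inter> walk_trace crv (z # B @ [t])"
    using pos_in_trace[OF assms(1)] pos_in_trace[OF assms(2)] by auto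
qed

end

section \<open>Paths and chords when all vertices lie on the outer face\<close>

locale outerplanar_graph = drawn_graph +
  assumes outerplanar: "outerplanar_drawing G pos crv"
begin

text \<open>The unbounded face is connected, misses \<open>J\<close> and does not fit into the
  bounded set \<open>inside J\<close>, so it lies outside \<open>J\<close>. The open set
  \<open>inside J\<close> then contains no point of its closure, in particular not
  \<open>pos v\<close>.\<close>

lemma vertex_not_inside:
  assumes "v \<in> V" "J \<subseteq> drawing_points G pos crv" "compact J"
  shows "pos v \<notin> inside J"
proof
  assume inside: "pos v \<in> inside J"
  obtain F where F: "F \<in> components (- drawing_points G pos crv)" "\<not> bounded F" "pos v \<in> frontier F"
    using outerplanar assms(1) unfolding outerplanar_drawing_def faces_def face_verts_def by blast
  have "F \<inter> J = {}" using in_components_subset[OF F(1)] assms(2) by blast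
  moreover have "Topological_Spaces.connected F" using F(1) in_components_connected by blast
  moreover have "\<not> F \<subseteq> inside J"
    using F(2) bounded_inside[OF compact_imp_bounded[OF assms(3)]] bounded_subset by blast
  ultimately have "F \<subseteq> outside J"
    using connected_inside_or_outside compact_imp_closed[OF assms(3)] by blast
  moreover have "pos v \<in> closure F" using F(3) by (simp add: frontier_def)
  moreover have "open (inside J)" using compact_imp_closed[OF assms(3)] by (rule open_inside)
  ultimately show False
    using inside inside_Int_outside[of J] open_Int_closure_eq_empty[of "inside J" F] by blast
qed

text \<open>At most one path may be a single edge. This covers three paths with inner vertices as
  well as a cycle with a chord.\<close>

lemma walks_theta_curve:
  assumes "walk E (z # A1 @ [t])" "walk E (z # A2 @ [t])" "walk E (z # A3 @ [t])"
    and "distinct (z # t # A1 @ A2 @ A3)"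
    and "A1 \<noteq> [] \<or> A2 \<noteq> []" "A1 \<noteq> [] \<or> A3 \<noteq> []" "A2 \<noteq> [] \<or> A3 \<noteq> []"
  obtains g1 g2 g3 where "theta_curve g1 g2 g3 (pos z) (pos t)"
    "path_image g1 = walk_trace crv (z # A1 @ [t])" "path_image g2 = walk_trace crv (z # A2 @ [t])"
    "path_image g3 = walk_trace crv (z # A3 @ [t])"
proof -
  have d: "distinct (z # A1 @ [t])" "distinct (z # A2 @ [t])" "distinct (z # A3 @ [t])"
    "distinct (z # t # A1 @ A2)" "distinct (z # t # A1 @ A3)" "distinct (z # t # A2 @ A3)"
    using assms(4) by auto
  from walk_arc[OF assms(1) d(1)] obtain g1 where g1: "Path_Connected.arc g1" "pathstart g1 = pos z"
    "pathfinish g1 = pos t" "path_image g1 = walk_trace crv (z # A1 @ [t])" by auto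
  from walk_arc[OF assms(2) d(2)] obtain g2 where g2: "Path_Connected.arc g2" "pathstart g2 = pos z"
    "pathfinish g2 = pos t" "path_image g2 = walk_trace crv (z # A2 @ [t])" by auto
  from walk_arc[OF assms(3) d(3)] obtain g3 where g3: "Path_Connected.arc g3" "pathstart g3 = pos z"
    "pathfinish g3 = pos t" "path_image g3 = walk_trace crv (z # A3 @ [t])" by auto
  have "theta_curve g1 g2 g3 (pos z) (pos t)"
    by unfold_locales
      (simp_all add: g1 g2 g3 parallel_walks_meet[OF assms(1,2) d(4) assms(5)]
        parallel_walks_meet[OF assms(1,3) d(5) assms(6)] parallel_walks_meet[OF assms(2,3) d(6) assms(7)])
  then show ?thesis using that g1(4) g2(4) g3(4) by blast
qed

lemma walk_not_inside:
  assumes "walk E (z # A @ [t])" "distinct (z # A @ [t])" "A \<noteq> []"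
    "J \<subseteq> drawing_points G pos crv" "compact J"
  shows "\<not> walk_trace crv (z # A @ [t]) - {pos z, pos t} \<subseteq> inside J"
proof -
  have "set (z # A @ [t]) \<subseteq> V" by (rule walk_verts[OF assms(1) _ arcs_verts]) simp
  moreover obtain a where "a \<in> set A" using assms(3) by (meson last_in_set)
  moreover have "pos a \<in> walk_trace crv (z # A @ [t])" if "a \<in> set A" for a
    using pos_in_trace[OF assms(1)] that by simp
  ultimately have "a \<in> V" "pos a \<in> walk_trace crv (z # A @ [t]) - {pos z, pos t}"
    using assms(2) pos_inj by auto
  then show ?thesis using vertex_not_inside[OF _ assms(4,5)] by blast
qed

lemma compact_walk_trace: "walk E xs \<Longrightarrow> compact (walk_trace crv xs)"
proof (induction xs rule: walk_edges.induct)
  case (1 x y zs)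
  then show ?case using edge_curve(1)[of x y] by (auto intro!: compact_Un simp: compact_arc_image)
qed auto

lemma compact_two_walks:
  assumes "walk E xs" "walk E ys"
  shows "walk_trace crv xs \<union> walk_trace crv ys \<subseteq> drawing_points G pos crv"
    "compact (walk_trace crv xs \<union> walk_trace crv ys)"
  using assms trace_subset_drawing compact_walk_trace by (auto intro: compact_Un)

lemma no_theta:
  assumes "walk E (z # A1 @ [t])" "walk E (z # A2 @ [t])" "walk E (z # A3 @ [t])"
    and d: "distinct (z # t # A1 @ A2 @ A3)" and "A1 \<noteq> []" "A2 \<noteq> []" "A3 \<noteq> []"
  shows False
proof -
  obtain g1 g2 g3 where "theta_curve g1 g2 g3 (pos z) (pos t)"
    and g: "path_image g1 = walk_trace crv (z # A1 @ [t])" "path_image g2 = walk_trace crv (z # A2 @ [t])"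
    "path_image g3 = walk_trace crv (z # A3 @ [t])"
    using walks_theta_curve[OF assms(1-4)] assms(5-7) by blast
  then interpret theta_curve g1 g2 g3 "pos z" "pos t" by simp
  have "distinct (z # A1 @ [t])" "distinct (z # A2 @ [t])" "distinct (z # A3 @ [t])" using d by auto
  then show False
    using some_arc_inside walk_not_inside[OF assms(1) _ assms(5) compact_two_walks[OF assms(2,3)]]
      walk_not_inside[OF assms(2) _ assms(6) compact_two_walks[OF assms(1,3)]]
      walk_not_inside[OF assms(3) _ assms(7) compact_two_walks[OF assms(1,2)]]
    unfolding g by blast
qed

text \<open>Some arc of the theta curve is drawn inside the other two. The two sides of the cycle
  have inner vertices, which cannot be there, so it is the chord.\<close>

lemma chord_inside:
  assumes walk: "walk E (i # A @ [j])" "walk E (i # B @ [j])" "(i, j) \<in> E"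
    and d: "distinct (i # j # A @ B)" and ne: "A \<noteq> []" "B \<noteq> []"
  obtains g1 g2 g3 where "theta_curve g1 g2 g3 (pos i) (pos j)"
    "path_image g1 = walk_trace crv (i # A @ [j])" "path_image g2 = walk_trace crv (i # B @ [j])"
    "path_image g3 = walk_trace crv [i, j]"
    "path_image g3 - {pos i, pos j} \<subseteq> inside (path_image g1 \<union> path_image g2)"
proof -
  have chord: "walk E (i # [] @ [j])" using walk(3) by simp
  obtain g1 g2 g3 where \<Theta>: "theta_curve g1 g2 g3 (pos i) (pos j)"
    and g: "path_image g1 = walk_trace crv (i # A @ [j])" "path_image g2 = walk_trace crv (i # B @ [j])"
    "path_image g3 = walk_trace crv (i # [] @ [j])"
    using walks_theta_curve[OF walk(1,2) chord] d ne by auto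
  interpret theta_curve g1 g2 g3 "pos i" "pos j" by (rule \<Theta>)
  have "distinct (i # A @ [j])" "distinct (i # B @ [j])" using d by auto
  then have "path_image g3 - {pos i, pos j} \<subseteq> inside (path_image g1 \<union> path_image g2)"
    using some_arc_inside walk_not_inside[OF walk(1) _ ne(1) compact_two_walks[OF walk(2) chord]]
      walk_not_inside[OF walk(2) _ ne(2) compact_two_walks[OF walk(1) chord]]
    unfolding g by blast
  then show ?thesis using that \<Theta> g by simp
qed

text \<open>Each chord forms a theta curve with the same cycle and is the inner arc of it. As
  \<open>k\<close> and \<open>l\<close> lie on different sides of the chord from \<open>i\<close> to
  \<open>j\<close>, the second chord would be an arc of the kind excluded by
  \<open>no_crossing_arc\<close>.\<close>

lemma no_crossing_chords:
  assumes cyc: "walk E (i # A @ k # B @ j # C @ l # D)" "(last (l # D), i) \<in> E"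
    and d: "distinct (i # A @ k # B @ j # C @ l # D)"
    and ij: "(i, j) \<in> E" and kl: "(k, l) \<in> E"
  shows False
proof -
  let ?T = "walk_trace crv"
  have P: "walk E (i # (A @ k # B) @ [j])" and Q: "walk E (i # (rev D @ l # rev C) @ [j])"
    using cycle_as_two_walks[OF sym_arcs, of i "A @ k # B" j "C @ l # D"] cyc by auto
  have walks: "walk E (i # A @ [k])" "walk E (k # B @ j # C @ l # D)" "walk E (j # C @ [l])"
    using cyc(1) walk_split[of E "i # A" k "B @ j # C @ l # D"] walk_split[of E "k # B" j "C @ l # D"]
      walk_split[of E "j # C" l D] by simp_all
  have "walk E ((i # A) @ [k])" using walks(1) by simp
  then have Ak: "walk E (i # A)" "(last (i # A), k) \<in> E" unfolding successively_append_iff by simp_all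
  \<comment> \<open>The same cycle, rotated to start at \<open>k\<close>, so that it can be cut at
    \<open>k\<close> and \<open>l\<close>.\<close>
  have "walk E ((k # B @ j # C @ l # D) @ i # A)"
    using walks(2) Ak(1) cyc(2) unfolding successively_append_iff by simp
  then have cyc': "walk E (k # (B @ j # C) @ l # D @ i # A)" by simp
  have "(last (l # D @ i # A), k) \<in> E" using Ak(2) by simp
  with cyc' have P': "walk E (k # (B @ j # C) @ [l])" and Q': "walk E (k # (rev A @ i # rev D) @ [l])"
    using cycle_as_two_walks[OF sym_arcs, of k "B @ j # C" l "D @ i # A"] by auto
  have dist: "distinct (i # j # (A @ k # B) @ rev D @ l # rev C)"
    "distinct (k # l # (B @ j # C) @ rev A @ i # rev D)" using d by auto
  have ne: "xs @ x # ys \<noteq> []" for xs ys :: "'a list" and x by simp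
  obtain g1 g2 g3 where "theta_curve g1 g2 g3 (pos i) (pos j)"
    and g: "path_image g1 = ?T (i # (A @ k # B) @ [j])" "path_image g2 = ?T (i # (rev D @ l # rev C) @ [j])"
    "path_image g3 = ?T [i, j]"
    and g3: "path_image g3 - {pos i, pos j} \<subseteq> inside (path_image g1 \<union> path_image g2)"
    using chord_inside[OF P Q ij dist(1) ne ne] by blast
  then interpret theta_curve g1 g2 g3 "pos i" "pos j" by simp
  obtain h1 h2 h3 where "theta_curve h1 h2 h3 (pos k) (pos l)"
    and h: "path_image h1 = ?T (k # (B @ j # C) @ [l])" "path_image h2 = ?T (k # (rev A @ i # rev D) @ [l])"
    "path_image h3 = ?T [k, l]"
    and h3: "path_image h3 - {pos k, pos l} \<subseteq> inside (path_image h1 \<union> path_image h2)"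
    using chord_inside[OF P' Q' kl dist(2) ne ne] by blast
  then interpret H: theta_curve h1 h2 h3 "pos k" "pos l" by simp
  \<comment> \<open>Cutting the cycle at either pair of vertices gives the same closed curve, so
    both chords are inside one and the same curve.\<close>
  have same: "path_image h1 \<union> path_image h2 = path_image g1 \<union> path_image g2"
    unfolding g h
    using trace_append[of crv "i # A" k "B @ [j]"] trace_append[of crv "i # rev D" l "rev C @ [j]"]
      trace_append[of crv "k # B" j "C @ [l]"] trace_append[of crv "k # rev A" i "rev D @ [l]"]
      trace_rev[OF walks(1)] trace_rev[OF walks(3)] by auto
  have verts: "i \<in> V" "j \<in> V" "k \<in> V" "l \<in> V" using ij kl arcs_verts by auto
  have "pos k \<in> path_image g1 - {pos i, pos j}" "pos l \<in> path_image g2 - {pos i, pos j}"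
    using pos_in_trace[OF P] pos_in_trace[OF Q] verts pos_inj d by (auto simp: g)
  moreover have "path_image h3 \<inter> path_image g3 = {}"
    using edge_curves_meet[OF kl ij] d by (auto simp: g h doubleton_eq_iff)
  moreover have chord: "walk E [i, j]" using ij by simp
  have "pos k \<notin> inside (path_image g2 \<union> path_image g3)" "pos l \<notin> inside (path_image g1 \<union> path_image g3)"
    unfolding g using vertex_not_inside[OF verts(3) compact_two_walks[OF Q chord]]
      vertex_not_inside[OF verts(4) compact_two_walks[OF P chord]] by auto
  ultimately show False
    using no_crossing_arc[OF H.arcs(3) H.starts(3) H.finishes(3)] g3 h3[unfolded same] by blast
qed

end

section \<open>Hamiltonian cycles of blocks\<close>

lemma rtrancl_walk:
  assumes "(x, y) \<in> r\<^sup>*"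
  shows "\<exists>xs. xs \<noteq> [] \<and> walk r xs \<and> distinct xs \<and> hd xs = x \<and> last xs = y"
  using assms
proof (induction rule: rtrancl_induct)
  case base
  show ?case by (rule exI[of _ "[x]"]) simp
next
  case (step y z)
  then obtain xs where xs: "xs \<noteq> []" "walk r xs" "distinct xs" "hd xs = x" "last xs = y" by blast
  show ?case
  proof (cases "z \<in> set xs")
    case True
    then obtain as bs where "xs = as @ z # bs" by (meson split_list)
    then show ?thesis using xs walk_split[of r as z bs]
      by (intro exI[of _ "as @ [z]"]) (cases as; auto)
  next
    case False
    then show ?thesis using xs step(2)
      by (intro exI[of _ "xs @ [z]"]) (auto simp: successively_append_iff)
  qed
qed

lemma rtrancl_leaves:
  assumes "(x, y) \<in> r\<^sup>*" "x \<in> S" "y \<notin> S"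
  obtains a b where "(a, b) \<in> r" "a \<in> S" "b \<notin> S"
  using assms by (induction rule: rtrancl_induct) blast+

definition cycle :: "('a \<times> 'a) set \<Rightarrow> 'a list \<Rightarrow> bool" where
  "cycle E xs \<longleftrightarrow> 2 \<le> length xs \<and> distinct xs \<and> walk E xs \<and> (last xs, hd xs) \<in> E"

lemma cycle_rotate:
  assumes "cycle E (as @ z # bs)"
  shows "cycle E (z # bs @ as)"
proof (cases as)
  case (Cons a as')
  have "walk E (as @ [z])" "walk E (z # bs)" "(last (z # bs), hd as) \<in> E"
    using assms walk_split[of E as z bs] Cons by (auto simp: cycle_def)
  then have "walk E as" "(last as, z) \<in> E" "walk E ((z # bs) @ as)"
    using Cons unfolding successively_append_iff by simp_all
  then show ?thesis using assms Cons by (auto simp: cycle_def)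
qed (use assms in auto)

text \<open>From here on the drawing is forgotten: the search for a Hamiltonian cycle needs of it
  only that no three parallel paths all have inner vertices.\<close>

locale theta_free_block =
  fixes E :: "('a \<times> 'a) set" and V :: "'a set"
  assumes finite: "finite V" and wf: "E \<subseteq> V \<times> V" and sym: "sym E" and irrefl: "(x, x) \<notin> E"
    and connected: "\<lbrakk>x \<in> V; y \<in> V\<rbrakk> \<Longrightarrow> (x, y) \<in> E\<^sup>*"
    and no_cut: "\<lbrakk>x \<in> V - {v}; y \<in> V - {v}\<rbrakk> \<Longrightarrow> (x, y) \<in> {(a, b) \<in> E. a \<noteq> v \<and> b \<noteq> v}\<^sup>*"
    and no_theta: "\<lbrakk>walk E (z # A1 @ [t]); walk E (z # A2 @ [t]); walk E (z # A3 @ [t]);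
      distinct (z # t # A1 @ A2 @ A3); A1 \<noteq> []; A2 \<noteq> []; A3 \<noteq> []\<rbrakk> \<Longrightarrow> False"
begin

lemma cycle_verts: "cycle E xs \<Longrightarrow> set xs \<subseteq> V"
  using walk_verts[OF _ _ wf] by (auto simp: cycle_def)

lemma longer_cycle:
  assumes xs: "cycle E xs" and ne: "set xs \<noteq> V"
  shows "\<exists>ys. cycle E ys \<and> length xs < length ys"
proof -
  have sub: "set xs \<subseteq> V" using xs by (rule cycle_verts)
  then obtain w where w: "w \<in> V" "w \<notin> set xs" using ne by blast
  have "hd xs \<in> set xs" using xs by (cases xs) (auto simp: cycle_def)
  then obtain z v where zv: "(z, v) \<in> E" "z \<in> set xs" "v \<notin> set xs"
    using rtrancl_leaves[OF connected[OF _ w(1), of "hd xs"] _ w(2)] sub by blast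
  obtain as bs where "xs = as @ z # bs" using zv(2) by (meson split_list)
  define ys where "ys = bs @ as"
  have cyc: "cycle E (z # ys)" and len: "length (z # ys) = length xs" and set: "set (z # ys) = set xs"
    using cycle_rotate xs \<open>xs = _\<close> by (auto simp: ys_def)
  then have "ys \<noteq> []" by (auto simp: cycle_def)
  then have hd: "hd ys \<in> V - {z}" using cyc sub set by (cases ys) (auto simp: cycle_def)
  have v: "v \<in> V - {z}" using zv wf by auto
  \<comment> \<open>Since \<open>z\<close> is no cut vertex, its neighbor \<open>v\<close> off the
    cycle reaches the rest of the cycle without \<open>z\<close>. The path, cut at its first return
    \<open>t\<close>, is an ear with distinct ends \<open>z\<close> and \<open>t\<close>.\<close>
  let ?r = "{(a, b) \<in> E. a \<noteq> z \<and> b \<noteq> z}"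
  obtain ps where ps: "ps \<noteq> []" "walk ?r ps" "distinct ps" "hd ps = v" "last ps = hd ys"
    using rtrancl_walk[OF no_cut[OF v hd]] by blast
  have psE: "walk E ps" using ps(2) by (rule successively_mono) auto
  \<comment> \<open>A walk with a single vertex imposes nothing on it, hence the condition on the
    head.\<close>
  have "z \<notin> set qs" if "walk ?r qs" "qs \<noteq> []" "hd qs \<noteq> z" for qs
    using that by (induction qs rule: walk_edges.induct) auto
  then have "z \<notin> set ps" using ps v by auto
  have "\<exists>x \<in> set ps. x \<in> set ys" using ps(1,5) \<open>ys \<noteq> []\<close> by (metis last_in_set list.set_sel(1))
  then obtain us t rest where split: "ps = us @ t # rest" "t \<in> set ys" "\<forall>x \<in> set us. x \<notin> set ys"
    using split_list_first_prop[of ps "\<lambda>x. x \<in> set ys"] by blast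
  have "us \<noteq> []" using split ps(4) zv(3) set by (cases us) auto
  have "hd us = v" using \<open>us \<noteq> []\<close> split ps(4) by simp
  have ust: "walk E (us @ [t])" using psE walk_split[of E us t rest] split(1) by simp
  then have ear: "walk E (z # us @ [t])" using zv(1) \<open>us \<noteq> []\<close> \<open>hd us = v\<close>
    by (cases us) auto
  obtain A D where AD: "ys = A @ t # D" using split(2) by (meson split_list)
  have last: "(last (t # D), z) \<in> E" using cyc AD by (auto simp: cycle_def)
  have walkA: "walk E (z # A @ [t])" and walkD: "walk E (z # rev D @ [t])"
    using cycle_as_two_walks[OF sym, of z A t D] cyc AD last by (auto simp: cycle_def)
  have dist: "distinct (z # t # us @ A @ D)"
    using cyc AD split ps(3) \<open>z \<notin> set ps\<close> by (auto simp: cycle_def)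
  \<comment> \<open>If one side is empty, \<open>z\<close> and \<open>t\<close> are neighbors on the
    cycle, and the ear, which has an inner vertex, replaces the edge between them. Otherwise the ear
    and both sides form a forbidden theta.\<close>
  consider "A = []" | "D = []" | "A \<noteq> []" "D \<noteq> []" by blast
  then show ?thesis
  proof cases
    case 1
    have "walk E (t # D)" using cyc AD walk_split[of E "z # A" t D] by (simp add: cycle_def)
    then have "walk E (z # us @ t # D)" using ear walk_split[of E "z # us" t D] by simp
    then have "cycle E (z # us @ t # D)" using last dist 1 by (auto simp: cycle_def)
    moreover have "length xs < length (z # us @ t # D)"
      using len AD 1 \<open>us \<noteq> []\<close> by (cases us) auto
    ultimately show ?thesis by blast
  next
    case 2
    have "walk E (rev (z # us @ [t]))" using ear by (rule walk_rev[OF sym])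
    then have r: "walk E ((t # rev us) @ [z])" by simp
    then have "walk E (t # rev us)" "(last (t # rev us), z) \<in> E"
      unfolding successively_append_iff by simp_all
    then have "walk E (z # A @ t # rev us)" using walkA walk_split[of E "z # A" t "rev us"] by simp
    then have "cycle E (z # A @ t # rev us)"
      using \<open>(last (t # rev us), z) \<in> E\<close> dist by (auto simp: cycle_def)
    moreover have "length xs < length (z # A @ t # rev us)"
      using len AD 2 \<open>us \<noteq> []\<close> by (cases us) auto
    ultimately show ?thesis by blast
  next
    case 3
    have "distinct (z # t # us @ A @ rev D)" using dist by auto
    then show ?thesis using no_theta[OF ear walkA walkD] 3 \<open>us \<noteq> []\<close> by auto
  qed
qed

lemma hamiltonian:
  assumes "x \<in> V" "y \<in> V" "x \<noteq> y"
  obtains xs where "cycle E xs" "set xs = V"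
proof -
  obtain a b where ab: "(a, b) \<in> E"
    using rtrancl_leaves[OF connected[OF assms(1,2)], of "{x}"] assms(3) by blast
  then have "cycle E [a, b]" using irrefl sym by (auto simp: cycle_def sym_def)
  moreover have "length xs \<le> card V" if "cycle E xs" for xs
    using card_mono[OF finite cycle_verts[OF that]] that by (simp add: cycle_def distinct_card)
  ultimately obtain xs where "cycle E xs" "\<And>ys. cycle E ys \<Longrightarrow> length ys \<le> length xs"
    using ex_has_greatest_nat[of "cycle E" "[a, b]" length "Suc (card V)"] by (auto simp: less_Suc_eq_le)
  then show ?thesis using that longer_cycle by (metis leD)
qed

end

section \<open>Coloring a cycle with noncrossing chords\<close>

text \<open>Only neighbors within the interval count, so for an end vertex this describes the share
  of its neighborhood that the interval contributes.\<close>

definition one_colored :: "(nat \<Rightarrow> nat \<Rightarrow> bool) \<Rightarrow> (nat \<Rightarrow> nat) \<Rightarrow> nat \<Rightarrow> nat \<Rightarrow> nat \<Rightarrow> nat \<Rightarrow> bool" where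
  "one_colored R C i j w k \<longleftrightarrow> (\<exists>!x. x \<in> {i..j} \<and> R w x \<and> C x = k)"

definition none_colored :: "(nat \<Rightarrow> nat \<Rightarrow> bool) \<Rightarrow> (nat \<Rightarrow> nat) \<Rightarrow> nat \<Rightarrow> nat \<Rightarrow> nat \<Rightarrow> nat \<Rightarrow> bool" where
  "none_colored R C i j w k \<longleftrightarrow> (\<forall>x \<in> {i..j}. R w x \<longrightarrow> C x \<noteq> k)"

definition inner_satisfied :: "(nat \<Rightarrow> nat \<Rightarrow> bool) \<Rightarrow> (nat \<Rightarrow> nat) \<Rightarrow> nat \<Rightarrow> nat \<Rightarrow> bool" where
  "inner_satisfied R C i j \<longleftrightarrow> (\<forall>w \<in> {i<..<j}. \<exists>k. one_colored R C i j w k)"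

definition glue :: "nat \<Rightarrow> (nat \<Rightarrow> nat) \<Rightarrow> (nat \<Rightarrow> nat) \<Rightarrow> nat \<Rightarrow> nat" where
  "glue m C D x = (if x \<le> m then C x else D x)"

text \<open>The induction invariant for an interval whose interior has no chord to the outside. The first
  vertex must not see the color \<open>u\<close>, because the rest of the graph supplies it; the last vertex sees
  its own color \<open>b\<close> exactly once or not at all, as requested. Since \<open>b\<close> differs from \<open>a\<close> and \<open>u\<close>,
  an edge between the two ends does not matter.\<close>

definition extendable :: "nat set \<Rightarrow> (nat \<Rightarrow> nat \<Rightarrow> bool) \<Rightarrow> nat \<Rightarrow> nat \<Rightarrow> bool" where
  "extendable K R i j \<longleftrightarrow> (\<forall>a \<in> K. \<forall>u \<in> K. \<forall>b \<in> K - {a, u}. \<forall>e.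
     \<exists>C. C \<in> {i..j} \<rightarrow> K \<and> C i = a \<and> C j = b \<and> none_colored R C i j i u \<and>
       (if e then one_colored R C i j j b else none_colored R C i j j b) \<and> inner_satisfied R C i j)"

text \<open>Arises with \<open>m\<close> the farthest neighbor of \<open>i\<close> before
  \<open>j\<close>. An edge between \<open>i\<close> and \<open>j\<close> has to be allowed, since
  they may be the ends of a chord or of the closing edge of the cycle. Conditions such as
  \<open>D j \<noteq> k\<close> and \<open>C i \<noteq> k\<close> in the gluing lemmas make it
  harmless.\<close>

locale split_interval =
  fixes R :: "nat \<Rightarrow> nat \<Rightarrow> bool" and i m j :: nat
  assumes order: "i < m" "m < j"
    and sym: "R x y \<Longrightarrow> R y x"
    and irrefl: "\<not> R x x"
    and separated: "\<lbrakk>x \<in> {i..<m}; y \<in> {m<..j}; R x y\<rbrakk> \<Longrightarrow> x = i \<and> y = j"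
begin

lemma none_glue_left:
  assumes "none_colored R C i m i k" "D j \<noteq> k"
  shows "none_colored R (glue m C D) i j i k"
  unfolding none_colored_def
proof (intro ballI impI)
  fix x assume x: "x \<in> {i..j}" "R i x"
  show "glue m C D x \<noteq> k"
  proof (cases "x \<le> m")
    case True then show ?thesis using assms x by (auto simp: none_colored_def glue_def)
  next
    case False then show ?thesis using assms x separated[of i x] order by (auto simp: glue_def)
  qed
qed

text \<open>Here the edge between the ends is exploited: \<open>j\<close> alone supplies the unique
  color of \<open>i\<close>.\<close>

lemma one_glue_first:
  assumes "none_colored R C i m i (D j)" "R i j"
  shows "one_colored R (glue m C D) i j i (D j)"
  unfolding one_colored_def
proof (rule ex1I[of _ j])
  show "j \<in> {i..j} \<and> R i j \<and> glue m C D j = D j" using assms order by (auto simp: glue_def)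
next
  fix x assume x: "x \<in> {i..j} \<and> R i x \<and> glue m C D x = D j"
  show "x = j"
  proof (cases "x \<le> m")
    case True then show ?thesis using assms x by (auto simp: none_colored_def glue_def)
  next
    case False then show ?thesis using x separated[of i x] order by auto
  qed
qed

lemma nbr_right:
  assumes "w \<in> {m<..j}" "x \<in> {i..j}" "R w x"
  shows "x \<in> {m..j} \<or> w = j \<and> x = i"
  using separated[of x w] sym[OF assms(3)] assms by fastforce

lemma nbr_left:
  assumes "w \<in> {i..<m}" "x \<in> {i..j}" "R w x"
  shows "x \<in> {i..m} \<or> w = i \<and> x = j"
  using separated[of w x] assms by fastforce

lemma none_glue_right:
  assumes "none_colored R D m j j k" "C i \<noteq> k" "C m = D m"
  shows "none_colored R (glue m C D) i j j k"
  unfolding none_colored_def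
proof (intro ballI impI)
  fix x assume x: "x \<in> {i..j}" "R j x"
  have "x \<in> {m..j} \<or> x = i" using nbr_right[of j x] x order by auto
  then show "glue m C D x \<noteq> k"
    using assms x order by (auto simp: none_colored_def glue_def)
qed

lemma one_glue_right:
  assumes "one_colored R D m j j k" "C i \<noteq> k" "C m = D m"
  shows "one_colored R (glue m C D) i j j k"
proof -
  have *: "x \<in> {i..j} \<and> R j x \<and> glue m C D x = k \<longleftrightarrow> x \<in> {m..j} \<and> R j x \<and> D x = k" for x
    using nbr_right[of j x] order assms(2,3) by (auto simp: glue_def)
  show ?thesis using assms(1) unfolding one_colored_def * .
qed

lemma one_glue_middle_left:
  assumes "one_colored R C i m m k" "none_colored R D m j m k" "C m = D m"
  shows "one_colored R (glue m C D) i j m k"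
proof -
  have *: "x \<in> {i..j} \<and> R m x \<and> glue m C D x = k \<longleftrightarrow> x \<in> {i..m} \<and> R m x \<and> C x = k" for x
    using order assms(2,3) by (auto simp: glue_def none_colored_def)
  show ?thesis using assms(1) unfolding one_colored_def * .
qed

lemma one_glue_middle_right:
  assumes "none_colored R C i m m k" "one_colored R D m j m k" "C m = D m"
  shows "one_colored R (glue m C D) i j m k"
proof -
  have *: "x \<in> {i..j} \<and> R m x \<and> glue m C D x = k \<longleftrightarrow> x \<in> {m..j} \<and> R m x \<and> D x = k" for x
    using order assms(1,3) irrefl by (auto simp: glue_def none_colored_def)
  show ?thesis using assms(2) unfolding one_colored_def * .
qed

lemma inner_glue:
  assumes "inner_satisfied R C i m" "inner_satisfied R D m j" "C m = D m"
    "one_colored R (glue m C D) i j m k"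
  shows "inner_satisfied R (glue m C D) i j"
  unfolding inner_satisfied_def
proof
  fix w assume w: "w \<in> {i<..<j}"
  consider "w < m" | "w = m" | "w > m" by linarith
  then show "\<exists>k. one_colored R (glue m C D) i j w k"
  proof cases
    case 1
    with w have "w \<in> {i<..<m}" by auto
    then obtain k where k: "one_colored R C i m w k" using assms(1) unfolding inner_satisfied_def by blast
    have *: "x \<in> {i..j} \<and> R w x \<and> glue m C D x = k \<longleftrightarrow> x \<in> {i..m} \<and> R w x \<and> C x = k" for x
      using nbr_left[of w x] 1 w order by (auto simp: glue_def)
    have "one_colored R (glue m C D) i j w k" using k unfolding one_colored_def * .
    then show ?thesis ..
  next
    case 2 then show ?thesis using assms by blast
  next
    case 3
    with w have "w \<in> {m<..<j}" by auto
    then obtain k where k: "one_colored R D m j w k" using assms(2) unfolding inner_satisfied_def by blast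
    have *: "x \<in> {i..j} \<and> R w x \<and> glue m C D x = k \<longleftrightarrow> x \<in> {m..j} \<and> R w x \<and> D x = k" for x
      using nbr_right[of w x] 3 w order assms(3) by (auto simp: glue_def)
    have "one_colored R (glue m C D) i j w k" using k unfolding one_colored_def * .
    then show ?thesis ..
  qed
qed

end

lemma fourth_color:
  assumes "4 \<le> card K"
  shows "\<exists>c \<in> K. c \<notin> {x, y, z :: nat}"
proof -
  have "card {x, y, z} < card K" using assms by (simp add: card_insert_if)
  then have "\<not> K \<subseteq> {x, y, z}" by (meson card_mono finite.emptyI finite.insertI leD)
  then show ?thesis by blast
qed

context split_interval
begin

lemma glue_Pi: "\<lbrakk>C \<in> {i..m} \<rightarrow> K; D \<in> {m..j} \<rightarrow> K\<rbrakk> \<Longrightarrow> glue m C D \<in> {i..j} \<rightarrow> K"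
  by (auto simp: glue_def Pi_def)

lemma glue_ends: "glue m C D i = C i" "glue m C D j = D j"
  using order by (auto simp: glue_def)

end

lemma extendableD:
  assumes "extendable K R i j" "a \<in> K" "u \<in> K" "b \<in> K" "b \<noteq> a" "b \<noteq> u"
  obtains C where "C \<in> {i..j} \<rightarrow> K" "C i = a" "C j = b" "none_colored R C i j i u"
    "if e then one_colored R C i j j b else none_colored R C i j j b" "inner_satisfied R C i j"
  using assms unfolding extendable_def by (metis Diff_iff empty_iff insert_iff)

definition two_colors :: "nat \<Rightarrow> nat \<Rightarrow> nat \<Rightarrow> nat \<Rightarrow> nat" where
  "two_colors i a b x = (if x = i then a else b)"

lemma edge_piece:
  fixes a b
  assumes "\<not> R i i" "\<not> R (Suc i) (Suc i)" "R i (Suc i)" "R (Suc i) i"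
  defines "E \<equiv> two_colors i a b"
  shows "E i = a" "E (Suc i) = b" "inner_satisfied R E i (Suc i)"
    "none_colored R E i (Suc i) i k \<longleftrightarrow> b \<noteq> k" "none_colored R E i (Suc i) (Suc i) k \<longleftrightarrow> a \<noteq> k"
    "one_colored R E i (Suc i) i k \<longleftrightarrow> b = k" "one_colored R E i (Suc i) (Suc i) k \<longleftrightarrow> a = k"
    "a \<in> K \<Longrightarrow> b \<in> K \<Longrightarrow> E \<in> {i..Suc i} \<rightarrow> K"
proof -
  have mem: "x \<in> {i..Suc i} \<longleftrightarrow> x = i \<or> x = Suc i" for x by auto
  have inner: "{i<..<Suc i} = {}" by auto
  have E: "E i = a" "E (Suc i) = b" by (simp_all add: E_def two_colors_def)
  then show "E i = a" "E (Suc i) = b" by this+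
  show "inner_satisfied R E i (Suc i)" unfolding inner_satisfied_def inner by blast
  have nbr: "x \<in> {i..Suc i} \<and> R i x \<longleftrightarrow> x = Suc i" "x \<in> {i..Suc i} \<and> R (Suc i) x \<longleftrightarrow> x = i" for x
    unfolding mem using assms(1-4) by blast+
  have "none_colored R E i (Suc i) w k \<longleftrightarrow> (\<forall>x. x \<in> {i..Suc i} \<and> R w x \<longrightarrow> E x \<noteq> k)"
    "one_colored R E i (Suc i) w k \<longleftrightarrow> (\<exists>!x. (x \<in> {i..Suc i} \<and> R w x) \<and> E x = k)" for w
    unfolding none_colored_def one_colored_def conj_assoc by blast+
  note * = this
  show "none_colored R E i (Suc i) i k \<longleftrightarrow> b \<noteq> k" "none_colored R E i (Suc i) (Suc i) k \<longleftrightarrow> a \<noteq> k"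
    "one_colored R E i (Suc i) i k \<longleftrightarrow> b = k" "one_colored R E i (Suc i) (Suc i) k \<longleftrightarrow> a = k"
    unfolding * nbr using E by blast+
  show "a \<in> K \<Longrightarrow> b \<in> K \<Longrightarrow> E \<in> {i..Suc i} \<rightarrow> K"
    using E unfolding Pi_def mem by blast
qed

text \<open>A single edge cannot meet the invariant: its last vertex sees only \<open>a\<close>,
  which differs from \<open>b\<close>, so the request to see \<open>b\<close> once fails. Edges are
  therefore a second kind of building block.\<close>

definition piece :: "nat set \<Rightarrow> (nat \<Rightarrow> nat \<Rightarrow> bool) \<Rightarrow> nat \<Rightarrow> nat \<Rightarrow> bool" where
  "piece K R i j \<longleftrightarrow> j = Suc i \<and> R i j \<or> extendable K R i j"

context split_interval
begin

text \<open>Everything hinges on a color \<open>k\<close> that \<open>m\<close> sees exactly once on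
  one side and never on the other. Which side supplies it depends on which pieces are single
  edges.\<close>

lemma extendable_glue:
  assumes K: "4 \<le> card K" and "piece K R i m" "piece K R m j"
  shows "extendable K R i j"
  unfolding extendable_def
proof (intro ballI allI)
  fix a u b e assume au: "a \<in> K" "u \<in> K" and "b \<in> K - {a, u}"
  then have b: "b \<in> K" "b \<noteq> a" "b \<noteq> u" by auto
  have "\<exists>C D k. C \<in> {i..m} \<rightarrow> K \<and> D \<in> {m..j} \<rightarrow> K \<and> C i = a \<and> D j = b \<and> C m = D m \<and>
     inner_satisfied R C i m \<and> inner_satisfied R D m j \<and> none_colored R C i m i u \<and>
     (if e then one_colored R D m j j b else none_colored R D m j j b) \<and>
     (one_colored R C i m m k \<and> none_colored R D m j m k \<or>
      none_colored R C i m m k \<and> one_colored R D m j m k)"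
  proof (cases "extendable K R m j")
    case right: True
    show ?thesis
    proof (cases "extendable K R i m")
      case left: True
      \<comment> \<open>On the left \<open>m\<close> sees its own color \<open>c\<close> once. The
        right interval gets \<open>c\<close> also as its forbidden color, so \<open>m\<close> does
        not see it there.\<close>
      obtain c where c: "c \<in> K" "c \<noteq> a" "c \<noteq> u" "c \<noteq> b" using fourth_color[OF K, of a u b] by blast
      obtain C where C: "C \<in> {i..m} \<rightarrow> K" "C i = a" "C m = c" "none_colored R C i m i u"
        "if True then one_colored R C i m m c else none_colored R C i m m c" "inner_satisfied R C i m"
        using extendableD[OF left au c(1-3), where e = True] by blast
      obtain D where D: "D \<in> {m..j} \<rightarrow> K" "D m = c" "D j = b" "none_colored R D m j m c"
        "if e then one_colored R D m j j b else none_colored R D m j j b" "inner_satisfied R D m j"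
        using extendableD[OF right c(1) c(1) b(1) c(4)[symmetric] c(4)[symmetric], where e = e] by blast
      show ?thesis
        using C D by (intro exI[of _ C] exI[of _ D] exI[of _ c]) simp
    next
      case False
      then have m: "m = Suc i" "R i m" using assms by (auto simp: piece_def)
      \<comment> \<open>The unique color of \<open>m\<close> is \<open>a\<close>, seen at
        \<open>i\<close> and forbidden on the right. As \<open>i\<close> sees \<open>c\<close>, it
        must differ from \<open>u\<close>; it may equal \<open>a\<close>.\<close>
      obtain c where c: "c \<in> K" "c \<noteq> u" "c \<noteq> b" using fourth_color[OF K, of u b b] by blast
      obtain D where D: "D \<in> {m..j} \<rightarrow> K" "D m = c" "D j = b" "none_colored R D m j m a"
        "if e then one_colored R D m j j b else none_colored R D m j j b" "inner_satisfied R D m j"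
        using extendableD[OF right c(1) au(1) b(1) c(3)[symmetric] b(2), where e = e] by blast
      have "R i (Suc i)" "R (Suc i) i" using m sym by auto
      note E = edge_piece[OF irrefl irrefl this, folded m(1)]
      show ?thesis
        using D E au b c
        by (intro exI[of _ "two_colors i a c"] exI[of _ D] exI[of _ a]) simp
    qed
  next
    case False
    then have j: "j = Suc m" "R m j" using assms by (auto simp: piece_def)
    have "R m (Suc m)" "R (Suc m) m" using j sym by auto
    note E = edge_piece[OF irrefl irrefl this, folded j(1)]
    show ?thesis
    proof (cases "extendable K R i m")
      case left: True
      obtain d where d: "d \<in> K" "d \<noteq> a" "d \<noteq> u" "d \<noteq> b" using fourth_color[OF K, of a u b] by blast
      \<comment> \<open>Within the right edge, \<open>j\<close> sees \<open>b\<close> exactly if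
        \<open>m\<close> has color \<open>b\<close>, so \<open>e\<close> dictates \<open>c\<close>.
        In both cases \<open>c\<close> is the unique color of \<open>m\<close>: if \<open>e\<close>
        holds, \<open>j\<close> shows it and the left interval must not; otherwise the left interval
        shows it once and \<open>j\<close> does not. Hence the request \<open>\<not> e\<close> on
        the left.\<close>
      define c where "c = (if e then b else d)"
      have c: "c \<in> K" "c \<noteq> a" "c \<noteq> u" using d b by (auto simp: c_def)
      obtain C where C: "C \<in> {i..m} \<rightarrow> K" "C i = a" "C m = c" "none_colored R C i m i u"
        "if \<not> e then one_colored R C i m m c else none_colored R C i m m c" "inner_satisfied R C i m"
        using extendableD[OF left au c, where e = "\<not> e"] by blast
      show ?thesis
        using C E c d b
        by (intro exI[of _ C] exI[of _ "two_colors m c b"] exI[of _ c]) (cases e; simp add: c_def)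
    next
      case False
      then have m: "m = Suc i" "R i m" using assms by (auto simp: piece_def)
      have "R i (Suc i)" "R (Suc i) i" using m sym by auto
      note F = edge_piece[OF irrefl irrefl this, folded m(1)]
      obtain d where d: "d \<in> K" "d \<noteq> u" "d \<noteq> b" using fourth_color[OF K, of u b b] by blast
      \<comment> \<open>Between two edges \<open>m\<close> sees \<open>a\<close> and
        \<open>b\<close>, which differ, so \<open>a\<close> is unique. The color of \<open>m\<close>
        only has to answer \<open>e\<close> at \<open>j\<close> and avoid \<open>u\<close> at
        \<open>i\<close>.\<close>
      define c where "c = (if e then b else d)"
      show ?thesis
        using E F d b au
        by (intro exI[of _ "two_colors i a c"] exI[of _ "two_colors m c b"] exI[of _ a])
          (cases e; simp add: c_def)
    qed
  qed
  then obtain C D k where CD: "C \<in> {i..m} \<rightarrow> K" "D \<in> {m..j} \<rightarrow> K" "C i = a" "D j = b" "C m = D m"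
     "inner_satisfied R C i m" "inner_satisfied R D m j" "none_colored R C i m i u"
     "if e then one_colored R D m j j b else none_colored R D m j j b"
     and k: "one_colored R C i m m k \<and> none_colored R D m j m k \<or>
      none_colored R C i m m k \<and> one_colored R D m j m k" by blast
  have "one_colored R (glue m C D) i j m k"
    using k CD one_glue_middle_left one_glue_middle_right by blast
  then have "inner_satisfied R (glue m C D) i j" using inner_glue CD(5-7) by blast
  moreover have "none_colored R (glue m C D) i j i u" using none_glue_left CD(4,8) b by blast
  moreover have "if e then one_colored R (glue m C D) i j j b else none_colored R (glue m C D) i j j b"
    using CD(3,5,9) b one_glue_right[of D b C] none_glue_right[of D b C] by (cases e) auto
  ultimately show "\<exists>C. C \<in> {i..j} \<rightarrow> K \<and> C i = a \<and> C j = b \<and> none_colored R C i j i u \<and>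
       (if e then one_colored R C i j j b else none_colored R C i j j b) \<and> inner_satisfied R C i j"
    using glue_Pi[OF CD(1,2)] glue_ends CD(3,4) by blast
qed

text \<open>The first vertex takes the color of the last one as its unique color.\<close>

lemma complete_coloring_glue:
  assumes K: "4 \<le> card K" and "piece K R i m" "piece K R m j" "R i j"
  obtains C where "C \<in> {i..j} \<rightarrow> K" "\<And>w. w \<in> {i..j} \<Longrightarrow> \<exists>k. one_colored R C i j w k"
proof -
  obtain a where a: "a \<in> K" using fourth_color[OF K, of 0 0 0] by blast
  obtain b where b: "b \<in> K" "b \<noteq> a" using fourth_color[OF K, of a a a] by blast
  obtain c where c: "c \<in> K" "c \<noteq> a" "c \<noteq> b" using fourth_color[OF K, of a b b] by blast
  note abc = a b(1) c(1) b(2) c(2,3)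
  \<comment> \<open>The color that \<open>m\<close> sees once on the left: its own, or that of
    \<open>i\<close> if the left piece is a mere edge. The right piece has to avoid it.\<close>
  define k where "k = (if extendable K R i m then c else a)"
  obtain C where C: "C \<in> {i..m} \<rightarrow> K" "C i = a" "C m = c" "none_colored R C i m i b"
    "inner_satisfied R C i m" "one_colored R C i m m k"
  proof (cases "extendable K R i m")
    case True
    from extendableD[OF True abc(1-3,5,6), where e = True, unfolded if_True]
    obtain C where "C \<in> {i..m} \<rightarrow> K" "C i = a" "C m = c" "none_colored R C i m i b"
      "inner_satisfied R C i m" "one_colored R C i m m c" by blast
    then show ?thesis using that True by (simp add: k_def)
  next
    case False
    then have m: "m = Suc i" "R i m" using assms by (auto simp: piece_def)
    have "R i (Suc i)" "R (Suc i) i" using m sym by auto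
    note E = edge_piece[OF irrefl irrefl this, folded m(1)]
    show ?thesis
      by (rule that[of "two_colors i a c"]) (use E abc False in \<open>simp_all add: k_def\<close>)
  qed
  \<comment> \<open>The color \<open>l\<close> is to be unique at \<open>j\<close>; with
    \<open>l \<noteq> a\<close> it stays unique when the edge to \<open>i\<close> adds the color
    \<open>a\<close>.\<close>
  obtain D l where D: "D \<in> {m..j} \<rightarrow> K" "D m = c" "D j = b" "none_colored R D m j m k"
    "inner_satisfied R D m j" "one_colored R D m j j l" "l \<noteq> a"
  proof (cases "extendable K R m j")
    case True
    have "k \<in> K" "b \<noteq> k" using abc by (auto simp: k_def)
    from extendableD[OF True abc(3) this(1) abc(2) abc(6)[symmetric] this(2), where e = True, unfolded if_True]
    obtain D where "D \<in> {m..j} \<rightarrow> K" "D m = c" "D j = b" "none_colored R D m j m k"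
      "inner_satisfied R D m j" "one_colored R D m j j b" by blast
    then show ?thesis using that[of D b] abc(4) by simp
  next
    case False
    then have j: "j = Suc m" "R m j" using assms by (auto simp: piece_def)
    have "R m (Suc m)" "R (Suc m) m" using j sym by auto
    note E = edge_piece[OF irrefl irrefl this, folded j(1)]
    show ?thesis
      by (rule that[of "two_colors m c b" c]) (use E abc in \<open>simp_all add: k_def\<close>)
  qed
  have "C m = D m" using C D by simp
  have "one_colored R (glue m C D) i j m k"
    using one_glue_middle_left C D \<open>C m = D m\<close> by blast
  then have "inner_satisfied R (glue m C D) i j" using inner_glue C D \<open>C m = D m\<close> by blast
  moreover have "one_colored R (glue m C D) i j i b"
    using one_glue_first[of C D] C D \<open>R i j\<close> by simp
  moreover have "one_colored R (glue m C D) i j j l"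
    using one_glue_right[of D l C] C D by auto
  moreover have "w = i \<or> w = j \<or> w \<in> {i<..<j}" if "w \<in> {i..j}" for w using that by auto
  ultimately have "\<exists>k. one_colored R (glue m C D) i j w k" if "w \<in> {i..j}" for w
    using that unfolding inner_satisfied_def by blast
  with glue_Pi[OF C(1) D(1)] that show ?thesis by blast
qed

end

section \<open>Recursive splitting of a cycle with noncrossing chords\<close>

locale noncrossing_chords =
  fixes R :: "nat \<Rightarrow> nat \<Rightarrow> bool" and n :: nat
  assumes sym: "R x y \<Longrightarrow> R y x"
    and irrefl: "\<not> R x x"
    and step: "Suc x < n \<Longrightarrow> R x (Suc x)"
    and noncrossing: "\<lbrakk>i < k; k < j; j < l; l < n; R i j\<rbrakk> \<Longrightarrow> \<not> R k l"
begin

definition isolated :: "nat \<Rightarrow> nat \<Rightarrow> bool" where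
  "isolated i j \<longleftrightarrow> (\<forall>x \<in> {i<..<j}. \<forall>y < n. R x y \<longrightarrow> y \<in> {i..j})"

text \<open>Take for \<open>m\<close> the farthest neighbor of \<open>i\<close> before
  \<open>j\<close>; the successor of \<open>i\<close> is a candidate. An edge passing over
  \<open>m\<close> from strictly between \<open>i\<close> and \<open>m\<close> would cross the edge
  from \<open>i\<close> to \<open>m\<close>, and one from \<open>i\<close> itself can only end in
  \<open>j\<close> by maximality.\<close>

lemma isolated_split:
  assumes "isolated i j" "Suc i < j" "j < n"
  obtains m where "split_interval R i m j" "isolated i m" "isolated m j"
proof -
  let ?M = "{m \<in> {i<..<j}. R i m}"
  define m where "m = Max ?M"
  have "Suc i \<in> ?M" using assms step by auto
  then have "m \<in> ?M" unfolding m_def by (intro Max_in) auto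
  then have m: "i < m" "m < j" "R i m" by auto
  have max: "x \<le> m" if "i < x" "x < j" "R i x" for x
    unfolding m_def using that by (intro Max_ge) auto
  have sep: "x = i \<and> y = j" if "x \<in> {i..<m}" "y \<in> {m<..j}" "R x y" for x y
    using noncrossing[of i x m y] max[of y] that m assms sym[OF that(3)]
    unfolding isolated_def by (cases "x = i"; cases "y = j") force+
  show ?thesis
  proof (rule that)
    show "split_interval R i m j" by unfold_locales (use m sym irrefl sep in auto)
    show "isolated i m" unfolding isolated_def
    proof (intro ballI allI impI)
      fix x y assume *: "x \<in> {i<..<m}" "y < n" "R x y"
      then have "y \<in> {i..j}" using assms m unfolding isolated_def by force
      then show "y \<in> {i..m}" using * sep[of x y] by force
    qed
    show "isolated m j" unfolding isolated_def
    proof (intro ballI allI impI)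
      fix x y assume *: "x \<in> {m<..<j}" "y < n" "R x y"
      then have "y \<in> {i..j}" using assms m unfolding isolated_def by force
      then show "y \<in> {m..j}" using * sep[of y x] sym[of x y] by force
    qed
  qed
qed

lemma extendable_isolated:
  assumes "4 \<le> card K" "isolated i j" "Suc i < j" "j < n"
  shows "extendable K R i j"
  using assms(2-)
proof (induction "j - i" arbitrary: i j rule: less_induct)
  case less
  obtain m where m: "split_interval R i m j" "isolated i m" "isolated m j"
    using isolated_split less.prems by blast
  interpret split_interval R i m j by (rule m)
  have piece: "piece K R x y" if "isolated x y" "x < y" "y < n" "y - x < j - i" for x y
    using step[of x] less.hyps[OF that(4,1)] that by (cases "y = Suc x") (auto simp: piece_def)
  have "piece K R i m" "piece K R m j"
    using m(2,3) order less.prems by (auto intro!: piece)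
  then show ?case using extendable_glue assms(1) by blast
qed

lemma isolated_full: "isolated 0 (n - 1)"
  by (auto simp: isolated_def)

lemma complete_coloring:
  fixes K :: "nat set"
  assumes "4 \<le> card K" "3 \<le> n" "R 0 (n - 1)"
  obtains C where "C \<in> {..<n} \<rightarrow> K" "\<And>w. w < n \<Longrightarrow> \<exists>k. \<exists>!x. x < n \<and> R w x \<and> C x = k"
proof -
  have "Suc 0 < n - 1" "n - 1 < n" using assms by auto
  then obtain m where m: "split_interval R 0 m (n - 1)" "isolated 0 m" "isolated m (n - 1)"
    using isolated_split[OF isolated_full] by blast
  interpret split_interval R 0 m "n - 1" by (rule m)
  have piece: "piece K R x y" if "isolated x y" "x < y" "y < n" for x y
    using step[of x] extendable_isolated[OF assms(1) that(1)] that
    by (cases "y = Suc x") (auto simp: piece_def)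
  have "piece K R 0 m" "piece K R m (n - 1)"
    using m(2,3) order assms(2) by (auto intro!: piece)
  then obtain C where C: "C \<in> {0..n-1} \<rightarrow> K" "\<And>w. w \<in> {0..n-1} \<Longrightarrow> \<exists>k. one_colored R C 0 (n-1) w k"
    using complete_coloring_glue[OF assms(1) _ _ assms(3)] by blast
  have eq: "{0..n-1} = {..<n}" using assms by auto
  show ?thesis
    using that[of C] C unfolding one_colored_def eq lessThan_iff by blast
qed

lemma rooted_coloring:
  fixes K :: "nat set"
  assumes "4 \<le> card K" "3 \<le> n" "c \<in> K" "u \<in> K"
  obtains C where "C \<in> {..<n} \<rightarrow> K" "C 0 = c" "\<And>x. x < n \<Longrightarrow> R 0 x \<Longrightarrow> C x \<noteq> u"
    "\<And>w. 0 < w \<Longrightarrow> w < n \<Longrightarrow> \<exists>k. \<exists>!x. x < n \<and> R w x \<and> C x = k"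
proof -
  have ext: "extendable K R 0 (n - 1)"
    using extendable_isolated[OF assms(1) isolated_full] assms by auto
  obtain b where b: "b \<in> K" "b \<noteq> c" "b \<noteq> u" using fourth_color[OF assms(1), of c u u] by blast
  obtain C where C: "C \<in> {0..n-1} \<rightarrow> K" "C 0 = c" "none_colored R C 0 (n-1) 0 u"
    "one_colored R C 0 (n-1) (n-1) b" "inner_satisfied R C 0 (n-1)"
    \<comment> \<open>The choice \<open>e = True\<close> gives the last vertex its own color
      \<open>b\<close> as unique color; all other vertices except the root are inner.\<close>
    using extendableD[OF ext assms(3,4) b, where e = True, unfolded if_True] by blast
  have eq: "{0..n-1} = {..<n}" using assms by auto
  have "\<exists>k. one_colored R C 0 (n-1) w k" if "0 < w" "w < n" for w
    using C that unfolding inner_satisfied_def by (cases "w = n - 1") auto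
  then show ?thesis
    using that[of C] C(1-3) unfolding one_colored_def none_colored_def eq Ball_def lessThan_iff by blast
qed

end

section \<open>Coloring blocks\<close>

lemma drop_nth_drop:
  "\<lbrakk>m \<le> k; k < length xs\<rbrakk> \<Longrightarrow> drop m xs = take (k - m) (drop m xs) @ xs ! k # drop (Suc k) xs"
  using id_take_nth_drop[of "k - m" "drop m xs"] by simp

lemma color_along_list:
  assumes "distinct xs"
  obtains D where "\<And>p. p < length xs \<Longrightarrow> D (xs ! p) = C p"
proof (rule that)
  fix p assume "p < length xs"
  then show "C (inv_into {..<length xs} (nth xs) (xs ! p)) = C p"
    using inj_on_nth[OF assms, of "{..<length xs}"] by simp
qed

text \<open>The bound on \<open>q\<close> appears twice because the chord relation on positions
  carries it as well.\<close>

lemma has_unique_color_along_list: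
  assumes "distinct xs" "parcs B \<subseteq> set xs \<times> set xs" and D: "\<And>p. p < length xs \<Longrightarrow> D (xs ! p) = C p"
    and "\<exists>k. \<exists>!q. q < length xs \<and> (q < length xs \<and> (xs ! p, xs ! q) \<in> parcs B) \<and> C q = k"
  shows "has_unique_color B D (xs ! p)"
proof -
  obtain k q where q: "q < length xs" "(xs ! p, xs ! q) \<in> parcs B" "C q = k"
    and uniq: "\<And>q'. \<lbrakk>q' < length xs; (xs ! p, xs ! q') \<in> parcs B; C q' = k\<rbrakk> \<Longrightarrow> q' = q"
    using assms(4) by blast
  have "\<exists>!x. (xs ! p, x) \<in> parcs B \<and> D x = k"
  proof (rule ex1I[of _ "xs ! q"])
    show "(xs ! p, xs ! q) \<in> parcs B \<and> D (xs ! q) = k" using q D by simp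
    fix x assume x: "(xs ! p, x) \<in> parcs B \<and> D x = k"
    then have "x \<in> set xs" using assms(2) by blast
    then obtain q' where "q' < length xs" "x = xs ! q'" by (auto simp: in_set_conv_nth)
    then show "x = xs ! q" using x uniq D by auto
  qed
  then show ?thesis unfolding has_unique_color_def by blast
qed

context outerplanar_graph
begin

lemma block_arcs:
  assumes "block G B"
  shows "parcs B \<subseteq> E"
  using assms by (auto simp: block_def pre_digraph.max_subgraph_def subgraph_def)

lemma block_theta_free:
  assumes "block G B"
  shows "theta_free_block (parcs B) (pverts B)"
proof -
  have B: "graph (with_proj B)" "Digraph_Component.connected (with_proj B)" "\<And>v. \<not> cut_vertex (with_proj B) v"
    using assms by (auto simp: block_def pre_digraph.max_subgraph_def)
  interpret B: graph "with_proj B" by (rule B(1))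
  have reach: "reachable (with_proj B) x y" if "x \<in> pverts B" "y \<in> pverts B" for x y
    using B(2) that B.reachable_mk_symmetric_eq[OF B.sym_arcs]
    by (auto simp: Digraph_Component.connected_def strongly_connected_def)
  show ?thesis
  proof
    show "finite (pverts B)" using B.finite_verts by simp
    show "parcs B \<subseteq> pverts B \<times> pverts B" using B.wellformed by fastforce
    show "sym (parcs B)" using B.sym_arcs by (simp add: symmetric_def)
    show "(x, x) \<notin> parcs B" for x using B.no_loops by fastforce
    show "(x, y) \<in> (parcs B)\<^sup>*" if "x \<in> pverts B" "y \<in> pverts B" for x y
      using reachable_rtranclI[OF reach[OF that]] by simp
    show "(x, y) \<in> {(a, b) \<in> parcs B. a \<noteq> v \<and> b \<noteq> v}\<^sup>*"
      if "x \<in> pverts B - {v}" "y \<in> pverts B - {v}" for x y v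
    proof -
      have "reachable (pre_digraph.del_vert (with_proj B) v) x y"
      proof (cases "v \<in> pverts B")
        case True
        then show ?thesis using B(3)[of v] reach that by (auto simp: cut_vertex_def)
      next
        case False
        then have "pre_digraph.del_vert (with_proj B) v = with_proj B"
          using B.wellformed by (auto simp: pre_digraph.del_vert_def with_proj_def)
        then show ?thesis using reach that by simp
      qed
      moreover have "arcs_ends (pre_digraph.del_vert (with_proj B) v) = {(a, b) \<in> parcs B. a \<noteq> v \<and> b \<noteq> v}"
        by (auto simp: arcs_ends_conv pre_digraph.del_vert_def with_proj_def)
      ultimately show ?thesis using reachable_rtranclI by metis
    qed
    have mono: "walk E xs" if "walk (parcs B) xs" for xs
      using that by (rule successively_mono) (use block_arcs[OF assms] in blast)
    show False if "walk (parcs B) (z # A1 @ [t])" "walk (parcs B) (z # A2 @ [t])" "walk (parcs B) (z # A3 @ [t])"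
      "distinct (z # t # A1 @ A2 @ A3)" "A1 \<noteq> []" "A2 \<noteq> []" "A3 \<noteq> []" for z A1 t A2 A3
      using no_theta[OF mono[OF that(1)] mono[OF that(2)] mono[OF that(3)] that(4-7)] .
  qed
qed

lemma cycle_noncrossing:
  assumes cyc: "cycle E xs" and "E' \<subseteq> E" "sym E'" "\<And>x. (x, x) \<notin> E'" "walk E' xs"
  defines "R \<equiv> \<lambda>p q. p < length xs \<and> q < length xs \<and> (xs ! p, xs ! q) \<in> E'"
  shows "noncrossing_chords R (length xs)"
proof
  show "R y x" if "R x y" for x y using that assms(3) by (auto simp: R_def sym_def)
  show "\<not> R x x" for x using assms(4) by (auto simp: R_def)
  show "R x (Suc x)" if "Suc x < length xs" for x
    using assms(5) that by (auto simp: R_def successively_conv_nth)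
  show "\<not> R k l" if "i < k" "k < j" "j < l" "l < length xs" "R i j" for i k j l
  proof
    assume "R k l"
    have "xs = take i xs @ xs ! i # drop (Suc i) xs" using that by (intro id_take_nth_drop) simp
    also have "drop (Suc i) xs = take (k - Suc i) (drop (Suc i) xs) @ xs ! k # drop (Suc k) xs"
      using that by (intro drop_nth_drop) auto
    also have "drop (Suc k) xs = take (j - Suc k) (drop (Suc k) xs) @ xs ! j # drop (Suc j) xs"
      using that by (intro drop_nth_drop) auto
    also have "drop (Suc j) xs = take (l - Suc j) (drop (Suc j) xs) @ xs ! l # drop (Suc l) xs"
      using that by (intro drop_nth_drop) auto
    finally obtain P A B C D where xs: "xs = P @ xs ! i # A @ xs ! k # B @ xs ! j # C @ xs ! l # D" by blast
    \<comment> \<open>Rotated to start at an end of the first chord, as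
      \<open>no_crossing_chords\<close> expects.\<close>
    have "cycle E (xs ! i # (A @ xs ! k # B @ xs ! j # C @ xs ! l # D) @ P)"
      by (rule cycle_rotate) (use cyc xs in simp)
    then show False
      using no_crossing_chords[of "xs ! i" A "xs ! k" B "xs ! j" C "xs ! l" "D @ P"]
        \<open>R k l\<close> \<open>R i j\<close> assms(2) by (auto simp: cycle_def R_def)
  qed
qed

end

text \<open>A bounded open set lies inside its frontier, and a set with at most one point is convex,
  so nothing is inside it. Hence a block with a single vertex contains no inner face.\<close>

lemma bounded_face_frontier:
  assumes "F \<in> inner_faces G pos crv" "pair_graph G" "plane_drawing G pos crv"
  shows "\<not> frontier F \<subseteq> {p}"
proof
  assume sub: "frontier F \<subseteq> {p}"
  interpret G: pair_graph G by fact
  have F: "F \<in> components (- drawing_points G pos crv)" "bounded F"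
    using assms(1) by (auto simp: inner_faces_def faces_def)
  have "Path_Connected.arc (crv e)" if "e \<in> parcs G" for e
    using assms(3) that unfolding plane_drawing_def by (cases e) blast
  then have "closed (drawing_points G pos crv)"
    unfolding drawing_points_def
    using G.pair_finite_verts G.pair_finite_arcs
    by (intro closed_Un finite_imp_closed closed_UN) (auto simp: closed_arc_image)
  then have "open F" using F(1) open_components by blast
  then have "F \<subseteq> inside (frontier F)" using interior_inside_frontier[OF F(2)] by (simp add: interior_open)
  moreover have "convex (frontier F)" using sub by (auto simp: subset_singleton_iff)
  ultimately have "F = {}" using inside_convex by blast
  then show False using in_components_nonempty[OF F(1)] by simp
qed

theorem theorem3:
  fixes G B :: "'a pair_pre_digraph"
    and pos :: "'a \<Rightarrow> complex"
    and crv :: "'a \<times> 'a \<Rightarrow> real \<Rightarrow> complex"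
  assumes "pair_graph G"
    and "outerplanar_drawing G pos crv"
    and "block G B"
  shows "(single_edge B \<or>
            (\<exists>F \<in> inner_faces G pos crv. contains_face B pos crv F \<and> card (face_verts G pos F) \<noteq> 5)
          \<longrightarrow> (\<exists>C. conflict_free_coloring B {1, 2, 3, 4} C))
       \<and> (\<forall>v \<in> pverts B. \<forall>c \<in> {1, 2, 3, 4}. \<forall>u \<in> {1, 2, 3, 4}. c \<noteq> u \<longrightarrow>
            (\<exists>C \<in> pverts B \<rightarrow> {1, 2, 3, 4 :: nat}. C v = c \<and>
               (\<forall>x. (v, x) \<in> parcs B \<longrightarrow> C x \<noteq> u) \<and>
               (\<forall>w \<in> pverts B - {v}. has_unique_color B C w)))"
proof -
  have drawing: "plane_drawing G pos crv" using assms(2) by (simp add: outerplanar_drawing_def)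
  interpret outerplanar_graph G pos crv
    using assms(1,2) drawing by (simp add: outerplanar_graph_def drawn_graph_def outerplanar_graph_axioms_def)
  interpret B: theta_free_block "parcs B" "pverts B" using assms(3) by (rule block_theta_free)
  let ?K = "{1, 2, 3, 4 :: nat}"
  show ?thesis
  proof (cases "\<exists>x y. x \<in> pverts B \<and> y \<in> pverts B \<and> x \<noteq> y")
    \<comment> \<open>At most one vertex: the premise of the first claim fails, and in the second no
      vertex besides \<open>v\<close> asks for a unique color.\<close>
    case False
    have single: "\<exists>x. pverts B \<subseteq> {x}"
    proof (cases "pverts B = {}")
      case nonempty: False
      then obtain x where "x \<in> pverts B" by blast
      with False have "pverts B \<subseteq> {x}" by blast
      then show ?thesis by blast
    qed simp
    have no_arcs: "parcs B = {}" using B.wf B.irrefl False by blast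
    have not_single: "\<not> single_edge B" using no_arcs by (auto simp: single_edge_def)
    have no_face: "\<not> contains_face B pos crv F" if F: "F \<in> inner_faces G pos crv" for F
    proof
      assume "contains_face B pos crv F"
      then have "frontier F \<subseteq> pos ` pverts B" using no_arcs by (simp add: contains_face_def drawing_points_def)
      moreover obtain x where "pverts B \<subseteq> {x}" using single by blast
      ultimately have "frontier F \<subseteq> {pos x}" by blast
      then show False using bounded_face_frontier[OF F assms(1) drawing] by simp
    qed
    show ?thesis
    proof (intro conjI impI ballI)
      assume "single_edge B \<or>
        (\<exists>F \<in> inner_faces G pos crv. contains_face B pos crv F \<and> card (face_verts G pos F) \<noteq> 5)"
      then show "\<exists>C. conflict_free_coloring B ?K C" using not_single no_face by blast
    next
      fix v c u assume "v \<in> pverts B" "c \<in> ?K"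
      moreover from this have "pverts B - {v} = {}" using False by blast
      ultimately show "\<exists>C \<in> pverts B \<rightarrow> ?K. C v = c \<and> (\<forall>x. (v, x) \<in> parcs B \<longrightarrow> C x \<noteq> u) \<and>
               (\<forall>w \<in> pverts B - {v}. has_unique_color B C w)"
        using no_arcs by (intro bexI[of _ "\<lambda>_. c"]) auto
    qed
  next
    case True
    then obtain xs where xs: "cycle (parcs B) xs" "set xs = pverts B" using B.hamiltonian by blast
    show ?thesis
    proof (cases "3 \<le> length xs")
      case False
      have "2 \<le> length xs" using xs by (simp add: cycle_def)
      with False have "length xs = Suc (Suc 0)" by simp
      then obtain x y where "xs = [x, y]" by (auto simp: length_Suc_conv)
      with xs have xy: "pverts B = {x, y}" "x \<noteq> y" "(x, y) \<in> parcs B" "(y, x) \<in> parcs B"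
        by (auto simp: cycle_def)
      have "parcs B \<subseteq> {(x, y), (y, x)}" using B.wf B.irrefl xy(1) by auto
      then have "(w, z) \<in> parcs B \<longleftrightarrow> (w, z) = (x, y) \<or> (w, z) = (y, x)" for w z using xy by blast
      \<comment> \<open>Each end has just one neighbor, so every constant coloring works; the
        constant \<open>c\<close> also keeps \<open>u\<close> away from \<open>v\<close>, as
        \<open>c \<noteq> u\<close>.\<close>
      then have unique: "has_unique_color B (\<lambda>_. c) w" if "w \<in> pverts B" for c w
        using that xy(1,2) unfolding has_unique_color_def by auto
      show ?thesis
      proof (intro conjI impI ballI)
        have "conflict_free_coloring B ?K (\<lambda>_. 1)" using unique by (simp add: conflict_free_coloring_def)
        then show "\<exists>C. conflict_free_coloring B ?K C" by blast
      next
        fix v c u assume "c \<in> ?K" "c \<noteq> u"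
        then show "\<exists>C \<in> pverts B \<rightarrow> ?K. C v = c \<and> (\<forall>x. (v, x) \<in> parcs B \<longrightarrow> C x \<noteq> u) \<and>
               (\<forall>w \<in> pverts B - {v}. has_unique_color B C w)"
          using unique by (intro bexI[of _ "\<lambda>_. c"]) simp_all
      qed
    next
      case three: True
      have K: "4 \<le> card ?K" by simp
      have chords: "noncrossing_chords (\<lambda>p q. p < length ys \<and> q < length ys \<and> (ys ! p, ys ! q) \<in> parcs B) (length ys)"
        if "cycle (parcs B) ys" for ys
      proof (rule cycle_noncrossing)
        show walk: "walk (parcs B) ys" using that by (simp add: cycle_def)
        have "walk E ys" using walk by (rule successively_mono) (use block_arcs[OF assms(3)] in blast)
        then show "cycle E ys" using that block_arcs[OF assms(3)] by (auto simp: cycle_def)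
      qed (use block_arcs[OF assms(3)] B.sym B.irrefl in auto)
      show ?thesis
      proof (intro conjI impI ballI)
        let ?R = "\<lambda>p q. p < length xs \<and> q < length xs \<and> (xs ! p, xs ! q) \<in> parcs B"
        interpret noncrossing_chords ?R "length xs" using xs(1) by (rule chords)
        have dist: "distinct xs" and ne: "xs \<noteq> []" using xs(1) by (auto simp: cycle_def)
        have "(xs ! 0, xs ! (length xs - 1)) \<in> parcs B"
          using xs(1) ne B.sym by (auto simp: cycle_def hd_conv_nth last_conv_nth sym_def)
        then have "?R 0 (length xs - 1)" using ne by simp
        then obtain C where C: "C \<in> {..<length xs} \<rightarrow> ?K"
          "\<And>w. w < length xs \<Longrightarrow> \<exists>k. \<exists>!x. x < length xs \<and> ?R w x \<and> C x = k"
          using complete_coloring[OF K three] by blast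
        obtain D where D: "\<And>p. p < length xs \<Longrightarrow> D (xs ! p) = C p" using color_along_list[OF dist] by blast
        have pos: "\<exists>p < length xs. x = xs ! p" if "x \<in> pverts B" for x
          using that xs(2) by (metis in_set_conv_nth)
        have "conflict_free_coloring B ?K D"
          unfolding conflict_free_coloring_def
        proof
          show "D \<in> pverts B \<rightarrow> ?K"
          proof
            fix x assume "x \<in> pverts B"
            then obtain p where "p < length xs" "x = xs ! p" using pos by blast
            then show "D x \<in> ?K" using Pi_mem[OF C(1), of p] D by simp
          qed
          show "\<forall>w \<in> pverts B. has_unique_color B D w"
          proof
            fix w assume "w \<in> pverts B"
            then obtain p where p: "p < length xs" "w = xs ! p" using pos by blast
            have "has_unique_color B D (xs ! p)"
            proof (rule has_unique_color_along_list[OF dist])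
              show "parcs B \<subseteq> set xs \<times> set xs" using B.wf xs(2) by simp
              show "\<exists>k. \<exists>!q. q < length xs \<and> (q < length xs \<and> (xs ! p, xs ! q) \<in> parcs B) \<and> C q = k"
                using C(2)[OF p(1)] p(1) by simp
            qed (rule D)
            then show "has_unique_color B D w" using p(2) by simp
          qed
        qed
        then show "\<exists>C. conflict_free_coloring B ?K C" by blast
      next
        fix v c u assume v: "v \<in> pverts B" and cu: "c \<in> ?K" "u \<in> ?K" "c \<noteq> u"
        obtain as bs where "xs = as @ v # bs" using v xs(2) by (metis split_list)
        \<comment> \<open>The cycle is rotated so that \<open>v\<close> gets position 0, the root of
          \<open>rooted_coloring\<close>.\<close>
        define ys where "ys = v # bs @ as"
        have ys: "cycle (parcs B) ys" "set ys = pverts B" "length ys = length xs"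
          using cycle_rotate xs \<open>xs = _\<close> by (auto simp: ys_def)
        let ?R = "\<lambda>p q. p < length ys \<and> q < length ys \<and> (ys ! p, ys ! q) \<in> parcs B"
        interpret noncrossing_chords ?R "length ys" using ys(1) by (rule chords)
        have dist: "distinct ys" and ne: "ys \<noteq> []" and v0: "ys ! 0 = v" using ys(1) by (auto simp: cycle_def ys_def)
        have three': "3 \<le> length ys" using three ys(3) by simp
        obtain C where C: "C \<in> {..<length ys} \<rightarrow> ?K" "C 0 = c" "\<And>x. x < length ys \<Longrightarrow> ?R 0 x \<Longrightarrow> C x \<noteq> u"
          "\<And>w. 0 < w \<Longrightarrow> w < length ys \<Longrightarrow> \<exists>k. \<exists>!x. x < length ys \<and> ?R w x \<and> C x = k"
          using rooted_coloring[OF K three' cu(1,2)] by blast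
        obtain D where D: "\<And>p. p < length ys \<Longrightarrow> D (ys ! p) = C p" using color_along_list[OF dist] by blast
        have pos: "\<exists>p < length ys. x = ys ! p" if "x \<in> pverts B" for x
          using that ys(2) by (metis in_set_conv_nth)
        show "\<exists>C \<in> pverts B \<rightarrow> ?K. C v = c \<and> (\<forall>x. (v, x) \<in> parcs B \<longrightarrow> C x \<noteq> u) \<and>
               (\<forall>w \<in> pverts B - {v}. has_unique_color B C w)"
        proof (intro bexI conjI allI impI ballI)
          show "D \<in> pverts B \<rightarrow> ?K"
          proof
            fix x assume "x \<in> pverts B"
            then obtain p where "p < length ys" "x = ys ! p" using pos by blast
            then show "D x \<in> ?K" using Pi_mem[OF C(1), of p] D by simp
          qed
          show "D v = c" using D[of 0] C(2) v0 ne by simp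
          show "D x \<noteq> u" if "(v, x) \<in> parcs B" for x
          proof -
            have "x \<in> pverts B" using that B.wf by blast
            then obtain p where "p < length ys" "x = ys ! p" using pos by blast
            then show ?thesis using C(3)[of p] D that v0 ne by simp
          qed
          show "has_unique_color B D w" if "w \<in> pverts B - {v}" for w
          proof -
            obtain p where p: "p < length ys" "w = ys ! p" using pos \<open>w \<in> _\<close> by blast
            then have "0 < p" using \<open>w \<in> _\<close> v0 by (cases p) auto
            have "has_unique_color B D (ys ! p)"
            proof (rule has_unique_color_along_list[OF dist])
              show "parcs B \<subseteq> set ys \<times> set ys" using B.wf ys(2) by simp
              show "\<exists>k. \<exists>!q. q < length ys \<and> (q < length ys \<and> (ys ! p, ys ! q) \<in> parcs B) \<and> C q = k"
                using C(4)[OF \<open>0 < p\<close> p(1)] p(1) by simp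
            qed (rule D)
            then show ?thesis using p(2) by simp
          qed
        qed
      qed
    qed
  qed
qed

end
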